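(* Let $T$ be a consistent, recursively enumerable $\mathcal{L}$-theory extending $\mathsf{R}$. For every computable simulation $\alpha\colon A^\ast\to\mathbb{N}$ and every $\mathcal{L}$-formula $\mathsf{Pr}^{\alpha}(x)$ satisfying Löb$(T,\alpha)$, we have $T\not\vdash\neg\mathsf{Pr}^{\alpha}(\ulcorner\bot\urcorner^{\alpha})$.
   Context: Language: $\mathcal{L}$ is the first-order arithmetical language with symbols $\mathsf{0},\mathsf{S},+,\times,=,\neg,\wedge,\forall$. The finite alphabet $A$ consists of these symbols together with $\mathsf{v}$, $\prime$, $($ and $)$. $A^\ast$ is the set of nonempty finite strings over $A$, with concatenation $\ast$. Variables are $\mathsf{v}$ followed by finitely many strokes; terms and formulae are the usual well-formed (fully parenthesised, infix) strings in $A^\ast$. Other logical symbols are the usual abbreviations; $x\le y$ abbreviates $\exists z\, z+x=y$. $\overline{n}$ is the standard numeral of $n\in\mathbb{N}$. Numberings: a numbering of $A^\ast$ is an injective function $\alpha\colon A^\ast\to\mathbb{N}$. $\ulcorner\phi\urcorner^{\alpha}$ is the numeral $\overline{\alpha(\phi)}$. Computable simulation: let $G=\alpha(A^\ast)$ and let $\circledast_\alpha\colon G\times G\to G$ be $\circledast_\alpha(m,n)=\alpha(\alpha^{-1}(m)\ast\alpha^{-1}(n))$. $\alpha$ is a computable simulation (of $A^\ast$) if $G$ is decidable and $\circledast_\alpha$ is recursive (i.e. a partial recursive function with decidable domain $G\times G$). The theory $\mathsf{R}$ has the axiom schemata (for all $m,n\in\mathbb{N}$): $\overline{m}+\overline{n}=\overline{m+n}$;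 $\overline{m}\times\overline{n}=\overline{m\cdot n}$; $\overline{m}\neq\overline{n}$ for $m\ne n$; $x\le\overline{n}\to\bigvee_{k\le n}x=\overline{k}$; $x\le\overline{n}\vee\overline{n}\le x$. Löb's conditions relative to $\alpha$: a formula $\mathsf{Pr}^\alpha(x)$ satisfies Löb$(T,\alpha)$ if for all sentences $\phi,\psi$: (1) $T\vdash\phi$ implies $T\vdash\mathsf{Pr}^\alpha(\ulcorner\phi\urcorner^\alpha)$; (2) $T\vdash\mathsf{Pr}^\alpha(\ulcorner\phi\urcorner^\alpha)\wedge\mathsf{Pr}^\alpha(\ulcorner\phi\to\psi\urcorner^\alpha)\to\mathsf{Pr}^\alpha(\ulcorner\psi\urcorner^\alpha)$; (3) $T\vdash\mathsf{Pr}^\alpha(\ulcorner\phi\urcorner^\alpha)\to\mathsf{Pr}^\alpha(\ulcorner\mathsf{Pr}^\alpha(\ulcorner\phi\urcorner^\alpha)\urcorner^\alpha)$. $\bot$ is a fixed sentence refutable in $T$, such as $\mathsf{0}=\mathsf{S0}$. *)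

theory Defs
  imports Main "HOL-Library.Nat_Bijection"
begin

section \<open>The language\<close>

datatype letter =
  LZero | LSuc | LPlus | LTimes | LEq | LNot | LAnd | LAll | LVar | LPrime | LOpen | LClose

type_synonym str = "letter list"

text \<open>The nonempty strings; concatenation is list append.\<close>

definition A_star :: "str set" where
  "A_star = {w. w \<noteq> []}"

text \<open>Terms and formulae are represented by their parse trees.  The strings of the language are
  the images under \<open>str_tm\<close> and \<open>str_fm\<close>, and unique readability (\<open>str_fm_inject\<close> below)
  makes the two presentations interchangeable.  \<open>Var n\<close> is the letter \<open>v\<close> followed by
  \<open>n\<close> strokes.\<close>

datatype tm = Var nat | Zero | Suc_tm tm | Plus tm tm | Times tm tm

datatype fm = Eq tm tm | Neg fm | Con fm fm | All nat fm

primrec str_tm :: "tm \<Rightarrow> str" where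
  "str_tm (Var n) = LVar # replicate n LPrime"
| "str_tm Zero = [LZero]"
| "str_tm (Suc_tm t) = LSuc # str_tm t"
| "str_tm (Plus s t) = [LOpen] @ str_tm s @ [LPlus] @ str_tm t @ [LClose]"
| "str_tm (Times s t) = [LOpen] @ str_tm s @ [LTimes] @ str_tm t @ [LClose]"

primrec str_fm :: "fm \<Rightarrow> str" where
  "str_fm (Eq s t) = [LOpen] @ str_tm s @ [LEq] @ str_tm t @ [LClose]"
| "str_fm (Neg \<phi>) = LNot # str_fm \<phi>"
| "str_fm (Con \<phi> \<psi>) = [LOpen] @ str_fm \<phi> @ [LAnd] @ str_fm \<psi> @ [LClose]"
| "str_fm (All x \<phi>) = [LAll] @ str_tm (Var x) @ str_fm \<phi>"

subsection \<open>Unique readability\<close>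

definition no_stroke :: "str \<Rightarrow> bool" where
  "no_stroke u \<longleftrightarrow> (\<forall>v. u \<noteq> LPrime # v)"

lemma no_stroke_simps [simp]:
  "no_stroke []" "no_stroke (a # u) \<longleftrightarrow> a \<noteq> LPrime"
  by (auto simp: no_stroke_def)

lemma replicate_no_stroke:
  assumes "replicate m LPrime @ u = replicate n LPrime @ w" "no_stroke u" "no_stroke w"
  shows "m = n \<and> u = w"
  using assms
proof (induction m arbitrary: n)
  case 0
  then show ?case by (cases n) auto
next
  case (Suc m)
  then show ?case by (cases n) auto
qed

lemma str_tm_append_inject:
  assumes "str_tm s @ u = str_tm t @ w" "no_stroke u" "no_stroke w"
  shows "s = t \<and> u = w"
  using assms
proof (induction s arbitrary: t u w)
  case (Var n)
  then show ?case by (cases t) (auto dest: replicate_no_stroke)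
next
  case Zero
  then show ?case by (cases t) auto
next
  case (Suc_tm s)
  then show ?case by (cases t) auto
next
  case (Plus a b)
  from Plus.prems show ?case
    by (cases t) (auto dest!: Plus.IH)
next
  case (Times a b)
  from Times.prems show ?case
    by (cases t) (auto dest!: Times.IH)
qed

lemma str_fm_no_stroke [simp]: "no_stroke (str_fm \<phi> @ u)"
  by (cases \<phi>) auto

lemma str_tm_neq_str_fm: "no_stroke u \<Longrightarrow> str_tm t @ u \<noteq> str_fm \<phi> @ w"
proof (induction \<phi> arbitrary: t u w)
  case (Eq a b)
  then show ?case by (cases t) (auto dest!: str_tm_append_inject)
next
  case (Neg \<phi>)
  then show ?case by (cases t) auto
next
  case (Con \<phi> \<psi>)
  then show ?case by (cases t) auto
next
  case (All x \<phi>)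
  then show ?case by (cases t) auto
qed

lemma str_fm_append_inject:
  "str_fm \<phi> @ u = str_fm \<psi> @ w \<Longrightarrow> \<phi> = \<psi> \<and> u = w"
proof (induction \<phi> arbitrary: \<psi> u w)
  case (Eq a b)
  then show ?case
    by (cases \<psi>) (auto dest!: str_tm_append_inject simp: str_tm_neq_str_fm)
next
  case (Neg \<phi>)
  then show ?case by (cases \<psi>) auto
next
  case (Con \<phi>1 \<phi>2)
  from Con.prems show ?case
    by (cases \<psi>) (auto dest!: Con.IH simp: str_tm_neq_str_fm[symmetric])
next
  case (All x \<phi>)
  from All.prems show ?case
    by (cases \<psi>) (auto dest!: replicate_no_stroke All.IH)
qed

lemma str_fm_inject: "str_fm \<phi> = str_fm \<psi> \<longleftrightarrow> \<phi> = \<psi>"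
  using str_fm_append_inject[of \<phi> "[]" \<psi> "[]"] by auto

subsection \<open>Abbreviated symbols, variables and substitution\<close>

abbreviation Imp :: "fm \<Rightarrow> fm \<Rightarrow> fm" where
  "Imp \<phi> \<psi> \<equiv> Neg (Con \<phi> (Neg \<psi>))"

abbreviation Dis :: "fm \<Rightarrow> fm \<Rightarrow> fm" where
  "Dis \<phi> \<psi> \<equiv> Neg (Con (Neg \<phi>) (Neg \<psi>))"

abbreviation Ex :: "nat \<Rightarrow> fm \<Rightarrow> fm" where
  "Ex x \<phi> \<equiv> Neg (All x (Neg \<phi>))"

primrec vars :: "tm \<Rightarrow> nat set" where
  "vars (Var n) = {n}"
| "vars Zero = {}"
| "vars (Suc_tm t) = vars t"
| "vars (Plus s t) = vars s \<union> vars t"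
| "vars (Times s t) = vars s \<union> vars t"

primrec fv :: "fm \<Rightarrow> nat set" where
  "fv (Eq s t) = vars s \<union> vars t"
| "fv (Neg \<phi>) = fv \<phi>"
| "fv (Con \<phi> \<psi>) = fv \<phi> \<union> fv \<psi>"
| "fv (All x \<phi>) = fv \<phi> - {x}"

definition sentence :: "fm \<Rightarrow> bool" where
  "sentence \<phi> \<longleftrightarrow> fv \<phi> = {}"

primrec subst_tm :: "tm \<Rightarrow> nat \<Rightarrow> tm \<Rightarrow> tm" where
  "subst_tm (Var n) x t = (if n = x then t else Var n)"
| "subst_tm Zero x t = Zero"
| "subst_tm (Suc_tm r) x t = Suc_tm (subst_tm r x t)"
| "subst_tm (Plus r s) x t = Plus (subst_tm r x t) (subst_tm s x t)"
| "subst_tm (Times r s) x t = Times (subst_tm r x t) (subst_tm s x t)"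

text \<open>\<open>subst \<phi> x t\<close> replaces the free occurrences of \<open>x\<close> by \<open>t\<close>.  Bound variables are never
  renamed, so it is only meaningful when \<open>free_for t x \<phi>\<close> holds, as it does for closed \<open>t\<close>.\<close>

primrec subst :: "fm \<Rightarrow> nat \<Rightarrow> tm \<Rightarrow> fm" where
  "subst (Eq r s) x t = Eq (subst_tm r x t) (subst_tm s x t)"
| "subst (Neg \<phi>) x t = Neg (subst \<phi> x t)"
| "subst (Con \<phi> \<psi>) x t = Con (subst \<phi> x t) (subst \<psi> x t)"
| "subst (All y \<phi>) x t = (if y = x then All y \<phi> else All y (subst \<phi> x t))"

primrec free_for :: "tm \<Rightarrow> nat \<Rightarrow> fm \<Rightarrow> bool" where
  "free_for t x (Eq r s) \<longleftrightarrow> True"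
| "free_for t x (Neg \<phi>) \<longleftrightarrow> free_for t x \<phi>"
| "free_for t x (Con \<phi> \<psi>) \<longleftrightarrow> free_for t x \<phi> \<and> free_for t x \<psi>"
| "free_for t x (All y \<phi>) \<longleftrightarrow> x \<notin> fv (All y \<phi>) \<or> (y \<notin> vars t \<and> free_for t x \<phi>)"

primrec num :: "nat \<Rightarrow> tm" where
  "num 0 = Zero"
| "num (Suc n) = Suc_tm (num n)"

text \<open>The bound variable of \<open>s \<le> t\<close> is the first one that occurs in neither term.\<close>

definition Leq :: "tm \<Rightarrow> tm \<Rightarrow> fm" where
  "Leq s t = (let z = (LEAST z. z \<notin> vars s \<union> vars t) in Ex z (Eq (Plus (Var z) s) t))"

section \<open>Derivability\<close>

text \<open>Propositional evaluation, with equations and quantified formulae treated as atoms.\<close>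

primrec prop_val :: "(fm \<Rightarrow> bool) \<Rightarrow> fm \<Rightarrow> bool" where
  "prop_val v (Eq s t) = v (Eq s t)"
| "prop_val v (Neg \<phi>) \<longleftrightarrow> \<not> prop_val v \<phi>"
| "prop_val v (Con \<phi> \<psi>) \<longleftrightarrow> prop_val v \<phi> \<and> prop_val v \<psi>"
| "prop_val v (All x \<phi>) = v (All x \<phi>)"

definition tautology :: "fm \<Rightarrow> bool" where
  "tautology \<phi> \<longleftrightarrow> (\<forall>v. prop_val v \<phi>)"

text \<open>A Hilbert calculus for classical first-order logic with equality.  Generalisation is
  unrestricted, which is the usual consequence relation because the theories considered below
  consist of sentences.\<close>

inductive prv :: "fm set \<Rightarrow> fm \<Rightarrow> bool" (infix \<open>\<turnstile>\<close> 45) for T :: "fm set" where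
  ax: "\<phi> \<in> T \<Longrightarrow> T \<turnstile> \<phi>"
| taut: "tautology \<phi> \<Longrightarrow> T \<turnstile> \<phi>"
| spec: "free_for t x \<phi> \<Longrightarrow> T \<turnstile> Imp (All x \<phi>) (subst \<phi> x t)"
| dist: "x \<notin> fv \<phi> \<Longrightarrow> T \<turnstile> Imp (All x (Imp \<phi> \<psi>)) (Imp \<phi> (All x \<psi>))"
| eq_refl: "T \<turnstile> Eq t t"
| eq_subst: "free_for s x \<phi> \<Longrightarrow> free_for t x \<phi> \<Longrightarrow>
    T \<turnstile> Imp (Eq s t) (Imp (subst \<phi> x s) (subst \<phi> x t))"
| mp: "T \<turnstile> Imp \<phi> \<psi> \<Longrightarrow> T \<turnstile> \<phi> \<Longrightarrow> T \<turnstile> \<psi>"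
| gen: "T \<turnstile> \<phi> \<Longrightarrow> T \<turnstile> All x \<phi>"

text \<open>A theory is any set of sentences; closure under derivability is allowed but not required.\<close>

definition is_theory :: "fm set \<Rightarrow> bool" where
  "is_theory T \<longleftrightarrow> (\<forall>\<phi>\<in>T. sentence \<phi>)"

definition consistent :: "fm set \<Rightarrow> bool" where
  "consistent T \<longleftrightarrow> \<not> (\<exists>\<phi>. T \<turnstile> \<phi> \<and> T \<turnstile> Neg \<phi>)"

section \<open>The theory R\<close>

primrec eq_some_upto :: "tm \<Rightarrow> nat \<Rightarrow> fm" where
  "eq_some_upto t 0 = Eq t (num 0)"
| "eq_some_upto t (Suc n) = Dis (eq_some_upto t n) (Eq t (num (Suc n)))"

text \<open>The two schemata with a free variable enter as their universal closures.\<close>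

inductive_set R_axioms :: "fm set" where
  "Eq (Plus (num m) (num n)) (num (m + n)) \<in> R_axioms"
| "Eq (Times (num m) (num n)) (num (m * n)) \<in> R_axioms"
| "m \<noteq> n \<Longrightarrow> Neg (Eq (num m) (num n)) \<in> R_axioms"
| "All 0 (Imp (Leq (Var 0) (num n)) (eq_some_upto (Var 0) n)) \<in> R_axioms"
| "All 0 (Dis (Leq (Var 0) (num n)) (Leq (num n) (Var 0))) \<in> R_axioms"

definition extends_R :: "fm set \<Rightarrow> bool" where
  "extends_R T \<longleftrightarrow> (\<forall>\<phi>\<in>R_axioms. T \<turnstile> \<phi>)"

section \<open>Computability\<close>

text \<open>Programs for the partial recursive functions.  Arities are not tracked: for each \<open>k\<close>, the
  restrictions of \<open>run e\<close> to lists of length \<open>k\<close> are exactly the \<open>k\<close>-ary partial recursive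
  functions, \<open>None\<close> standing for divergence.\<close>

datatype prog = Zr | Sc | Proj nat | Comp prog "prog list" | PrimRec prog prog | Mu prog

fun run :: "prog \<Rightarrow> nat list \<Rightarrow> nat option" where
  "run Zr xs = Some 0"
| "run Sc xs = (case xs of [] \<Rightarrow> None | x # _ \<Rightarrow> Some (Suc x))"
| "run (Proj i) xs = (if i < length xs then Some (xs ! i) else None)"
| "run (Comp f gs) xs =
     (case those (map (\<lambda>g. run g xs) gs) of None \<Rightarrow> None | Some ys \<Rightarrow> run f ys)"
| "run (PrimRec f g) xs =
     (case xs of [] \<Rightarrow> None
      | n # ys \<Rightarrow> rec_nat (run f ys)
          (\<lambda>k r. case r of None \<Rightarrow> None | Some y \<Rightarrow> run g (k # y # ys)) n)"
| "run (Mu f) xs =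
     (if \<exists>n. run f (n # xs) = Some 0 \<and> (\<forall>m<n. run f (m # xs) \<noteq> None)
      then Some (LEAST n. run f (n # xs) = Some 0) else None)"

definition decidable_set :: "nat set \<Rightarrow> bool" where
  "decidable_set D \<longleftrightarrow> (\<exists>e. \<forall>n. run e [n] = Some (if n \<in> D then 1 else 0))"

definition decidable_rel :: "(nat \<times> nat) set \<Rightarrow> bool" where
  "decidable_rel D \<longleftrightarrow> (\<exists>e. \<forall>m n. run e [m, n] = Some (if (m, n) \<in> D then 1 else 0))"

definition re_set :: "nat set \<Rightarrow> bool" where
  "re_set D \<longleftrightarrow> (\<exists>e. \<forall>n. n \<in> D \<longleftrightarrow> run e [n] \<noteq> None)"

definition recursive2 :: "(nat \<Rightarrow> nat \<Rightarrow> nat option) \<Rightarrow> bool" where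
  "recursive2 f \<longleftrightarrow>
     (\<exists>e. \<forall>m n. run e [m, n] = f m n) \<and> decidable_rel {(m, n). f m n \<noteq> None}"

primrec letter_code :: "letter \<Rightarrow> nat" where
  "letter_code LZero = 0"
| "letter_code LSuc = 1"
| "letter_code LPlus = 2"
| "letter_code LTimes = 3"
| "letter_code LEq = 4"
| "letter_code LNot = 5"
| "letter_code LAnd = 6"
| "letter_code LAll = 7"
| "letter_code LVar = 8"
| "letter_code LPrime = 9"
| "letter_code LOpen = 10"
| "letter_code LClose = 11"

text \<open>A fixed effective numbering of strings.  It is used only to say what it means for a theory
  to be recursively enumerable, a notion that does not depend on the numbering under study.\<close>

definition std_code :: "str \<Rightarrow> nat" where
  "std_code w = list_encode (map letter_code w)"

definition re_theory :: "fm set \<Rightarrow> bool" where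
  "re_theory T \<longleftrightarrow> re_set ((\<lambda>\<phi>. std_code (str_fm \<phi>)) ` T)"

section \<open>Numberings\<close>

text \<open>A numbering is a function on the nonempty strings; the value at \<open>[]\<close> is irrelevant.\<close>

definition numbering :: "(str \<Rightarrow> nat) \<Rightarrow> bool" where
  "numbering \<alpha> \<longleftrightarrow> inj_on \<alpha> A_star"

definition code_concat :: "(str \<Rightarrow> nat) \<Rightarrow> nat \<Rightarrow> nat \<Rightarrow> nat option" where
  "code_concat \<alpha> m n =
     (if m \<in> \<alpha> ` A_star \<and> n \<in> \<alpha> ` A_star
      then Some (\<alpha> (inv_into A_star \<alpha> m @ inv_into A_star \<alpha> n)) else None)"

definition computable_simulation :: "(str \<Rightarrow> nat) \<Rightarrow> bool" where
  "computable_simulation \<alpha> \<longleftrightarrow>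
     numbering \<alpha> \<and> decidable_set (\<alpha> ` A_star) \<and> recursive2 (code_concat \<alpha>)"

definition quote :: "(str \<Rightarrow> nat) \<Rightarrow> fm \<Rightarrow> tm" where
  "quote \<alpha> \<phi> = num (\<alpha> (str_fm \<phi>))"

section \<open>Loeb's conditions\<close>

definition Loeb :: "fm set \<Rightarrow> (str \<Rightarrow> nat) \<Rightarrow> fm \<Rightarrow> nat \<Rightarrow> bool" where
  "Loeb T \<alpha> Pr x \<longleftrightarrow>
     (\<forall>\<phi>. sentence \<phi> \<longrightarrow> T \<turnstile> \<phi> \<longrightarrow> T \<turnstile> subst Pr x (quote \<alpha> \<phi>)) \<and>
     (\<forall>\<phi> \<psi>. sentence \<phi> \<longrightarrow> sentence \<psi> \<longrightarrow>
        T \<turnstile> Imp (Con (subst Pr x (quote \<alpha> \<phi>)) (subst Pr x (quote \<alpha> (Imp \<phi> \<psi>))))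
              (subst Pr x (quote \<alpha> \<psi>))) \<and>
     (\<forall>\<phi>. sentence \<phi> \<longrightarrow>
        T \<turnstile> Imp (subst Pr x (quote \<alpha> \<phi>))
              (subst Pr x (quote \<alpha> (subst Pr x (quote \<alpha> \<phi>)))))"

end

theory Submission
  imports Defs "HOL-Number_Theory.Cong"
begin

text \<open>Loeb's argument needs only a fixed point \<open>G\<close> of \<open>\<not> Pr\<close>, with \<open>G\<close> quoted through \<open>\<alpha>\<close>.  The diagonal
  function sends the code of \<open>\<phi>\<close> to the code of \<open>\<forall>p (p = m \<rightarrow> \<phi>)\<close>, where \<open>m\<close> is the code of \<open>\<phi>\<close>.  The
  string of this sentence is a concatenation of fixed strings, \<open>\<phi>\<close> and a numeral, and numerals
  arise by iterated concatenation; so the function is partial recursive as soon as \<open>\<alpha>\<close> turns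
  concatenation into a recursive operation.  Graphs of partial recursive functions have the form
  \<open>\<exists>w. S\<close> with \<open>S\<close> bounded, hence decided by R at numerals, and a leastness condition on the
  witness makes the representation provably functional in R.\<close>

section \<open>Simultaneous substitution\<close>

text \<open>Nothing relates the size of a code to the length of its string, and no rule is given for
  the codes of single letters. But only finitely many fixed strings occur, so their codes enter
  programs as constants, and concatenation supplies the rest. Since Loeb's conditions are assumed of
  \<open>Pr\<close>, all that \<open>T\<close> must prove about syntax is the value of one function
  at one numeral argument. This keeps R sufficient in spite of its lack of induction: sequences are
  coded, witnesses collected and minima chosen among standard numbers, outside the theory.

  Relations are predicates of assignments \<open>nat \<Rightarrow> nat\<close>, so their formulae
  are instantiated at all variables at once, which calls for simultaneous substitution. As bound
  variables are never renamed, some variables are reserved: 0 is bound in the axioms of R, 1 is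
  bound in \<open>Le\<close>, 2 holds the witness, and arguments and values of programs live from 3
  on.\<close>

primrec msubst_tm :: "(nat \<Rightarrow> tm) \<Rightarrow> tm \<Rightarrow> tm" where
  "msubst_tm \<tau> (Var n) = \<tau> n"
| "msubst_tm \<tau> Zero = Zero"
| "msubst_tm \<tau> (Suc_tm t) = Suc_tm (msubst_tm \<tau> t)"
| "msubst_tm \<tau> (Plus s t) = Plus (msubst_tm \<tau> s) (msubst_tm \<tau> t)"
| "msubst_tm \<tau> (Times s t) = Times (msubst_tm \<tau> s) (msubst_tm \<tau> t)"

primrec msubst :: "(nat \<Rightarrow> tm) \<Rightarrow> fm \<Rightarrow> fm" where
  "msubst \<tau> (Eq s t) = Eq (msubst_tm \<tau> s) (msubst_tm \<tau> t)"
| "msubst \<tau> (Neg \<phi>) = Neg (msubst \<tau> \<phi>)"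
| "msubst \<tau> (Con \<phi> \<psi>) = Con (msubst \<tau> \<phi>) (msubst \<tau> \<psi>)"
| "msubst \<tau> (All x \<phi>) = All x (msubst (\<tau>(x := Var x)) \<phi>)"

lemma vars_num [simp]: "vars (num n) = {}"
  by (induction n) auto

lemma finite_vars [simp]: "finite (vars t)"
  by (induction t) auto

lemma msubst_tm_cong: "(\<And>i. i \<in> vars t \<Longrightarrow> \<tau> i = \<rho> i) \<Longrightarrow> msubst_tm \<tau> t = msubst_tm \<rho> t"
  by (induction t) auto

lemma msubst_cong: "(\<And>i. i \<in> fv \<phi> \<Longrightarrow> \<tau> i = \<rho> i) \<Longrightarrow> msubst \<tau> \<phi> = msubst \<rho> \<phi>"
proof (induction \<phi> arbitrary: \<tau> \<rho>)
  case (Eq s t)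
  then show ?case by (auto intro!: msubst_tm_cong)
next
  case (All x \<phi>)
  have "msubst (\<tau>(x := Var x)) \<phi> = msubst (\<rho>(x := Var x)) \<phi>"
    using All.prems by (intro All.IH) auto
  then show ?case by simp
next
  case (Con \<phi> \<psi>)
  have "msubst \<tau> \<phi> = msubst \<rho> \<phi>" "msubst \<tau> \<psi> = msubst \<rho> \<psi>"
    using Con.prems by (auto intro!: Con.IH)
  then show ?case by simp
next
  case (Neg \<phi>)
  have "msubst \<tau> \<phi> = msubst \<rho> \<phi>"
    using Neg.prems by (auto intro!: Neg.IH)
  then show ?case by simp
qed

lemma msubst_tm_Var [simp]: "msubst_tm Var t = t"
  by (induction t) auto

lemma msubst_Var [simp]: "msubst Var \<phi> = \<phi>"
proof (induction \<phi>)
  case (All x \<phi>)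
  moreover have "Var(x := Var x) = Var" by auto
  ultimately show ?case by simp
qed auto

lemma msubst_tm_num [simp]: "msubst_tm \<tau> (num n) = num n"
  by (induction n) auto

lemma subst_tm_eq_msubst_tm: "subst_tm t x s = msubst_tm (Var(x := s)) t"
  by (induction t) auto

lemma subst_eq_msubst: "subst \<phi> x s = msubst (Var(x := s)) \<phi>"
proof (induction \<phi>)
  case (All y \<phi>)
  have "(Var(x := s))(x := Var x) = Var" "y \<noteq> x \<Longrightarrow> (Var(x := s))(y := Var y) = Var(x := s)"
    by auto
  with All show ?case
    by (cases "y = x") (simp_all del: fun_upd_apply)
qed (simp_all add: subst_tm_eq_msubst_tm del: fun_upd_apply)

lemma subst_tm_num [simp]: "subst_tm (num n) x s = num n"
  by (simp add: subst_tm_eq_msubst_tm)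

lemma subst_tm_fresh: "x \<notin> vars t \<Longrightarrow> subst_tm t x s = t"
  by (induction t) auto

lemma subst_fresh: "x \<notin> fv \<phi> \<Longrightarrow> subst \<phi> x s = \<phi>"
  by (induction \<phi>) (auto simp: subst_tm_fresh)

lemma subst_self [simp]: "subst \<phi> x (Var x) = \<phi>"
  by (simp add: subst_eq_msubst)

text \<open>No variable can be captured by such a substitution, whatever is bound in the formula.\<close>

definition tame :: "(nat \<Rightarrow> tm) \<Rightarrow> bool" where
  "tame \<tau> \<longleftrightarrow> (\<forall>i. vars (\<tau> i) \<subseteq> {i})"

lemma tame_simps [simp]:
  "tame Var" "tame (\<lambda>i. num (f i))" "tame \<tau> \<Longrightarrow> tame (\<tau>(x := num n))"
  "tame \<tau> \<Longrightarrow> tame (\<tau>(x := Var x))"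
  by (auto simp: tame_def)

lemma msubst_tm_msubst_tm:
  "msubst_tm \<rho> (msubst_tm \<tau> t) = msubst_tm (\<lambda>i. msubst_tm \<rho> (\<tau> i)) t"
  by (induction t) auto

text \<open>Tameness of the inner substitution is what the binder case needs: for
  \<open>i \<noteq> x\<close> the term \<open>\<tau> i\<close> does not contain \<open>x\<close>, so
  resetting \<open>\<rho>\<close> at \<open>x\<close> does not affect it.\<close>

lemma msubst_msubst:
  "tame \<tau> \<Longrightarrow> msubst \<rho> (msubst \<tau> \<phi>) = msubst (\<lambda>i. msubst_tm \<rho> (\<tau> i)) \<phi>"
proof (induction \<phi> arbitrary: \<rho> \<tau>)
  case (All x \<phi>)
  have "msubst_tm (\<rho>(x := Var x)) (\<tau> i) = msubst_tm \<rho> (\<tau> i)" if "i \<noteq> x" for i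
    using All.prems that by (intro msubst_tm_cong) (auto simp: tame_def)
  then have "(\<lambda>i. msubst_tm (\<rho>(x := Var x)) ((\<tau>(x := Var x)) i))
      = (\<lambda>i. msubst_tm \<rho> (\<tau> i))(x := Var x)"
    by auto
  moreover have "tame (\<tau>(x := Var x))" using All.prems by simp
  ultimately show ?case using All.IH by (simp del: fun_upd_apply)
qed (auto simp: msubst_tm_msubst_tm)

lemma vars_msubst_tm: "vars (msubst_tm \<tau> t) = (\<Union>i\<in>vars t. vars (\<tau> i))"
  by (induction t) auto

lemma fv_msubst: "tame \<tau> \<Longrightarrow> fv (msubst \<tau> \<phi>) = (\<Union>i\<in>fv \<phi>. vars (\<tau> i))"
proof (induction \<phi> arbitrary: \<tau>)
  case (All x \<phi>)
  have "x \<notin> vars (\<tau> i)" if "i \<noteq> x" for i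
    using that All.prems by (auto simp: tame_def)
  moreover have "tame (\<tau>(x := Var x))" using All.prems by simp
  then have "fv (msubst (\<tau>(x := Var x)) \<phi>) = (\<Union>i\<in>fv \<phi>. vars ((\<tau>(x := Var x)) i))"
    by (rule All.IH)
  ultimately show ?case by (auto split: if_splits)
qed (auto simp: vars_msubst_tm)

text \<open>Lets a variable that was left free be instantiated later; the other terms of
  \<open>\<tau>\<close> cannot contain it.\<close>

lemma subst_msubst:
  assumes "tame \<tau>" "\<tau> x = Var x"
  shows "subst (msubst \<tau> \<phi>) x t = msubst (\<tau>(x := t)) \<phi>"
proof -
  have "subst_tm (\<tau> i) x t = (\<tau>(x := t)) i" for i
    using assms by (cases "i = x") (auto simp: tame_def intro!: subst_tm_fresh)
  then have "(\<lambda>i. msubst_tm (Var(x := t)) (\<tau> i)) = \<tau>(x := t)"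
    unfolding subst_tm_eq_msubst_tm by (rule ext)
  with assms(1) show ?thesis
    by (simp add: subst_eq_msubst msubst_msubst del: fun_upd_apply)
qed

lemma fv_subst_num [simp]: "fv (subst \<phi> x (num n)) = fv \<phi> - {x}"
  by (auto simp: subst_eq_msubst fv_msubst split: if_splits)

lemma free_for_closed: "vars t = {} \<Longrightarrow> free_for t x \<phi>"
  by (induction \<phi>) auto

lemma free_for_num [simp]: "free_for (num n) x \<phi>"
  by (simp add: free_for_closed)

lemma free_for_self [simp]: "free_for (Var x) x \<phi>"
  by (induction \<phi>) auto

section \<open>Derivations\<close>

lemma taut1: "T \<turnstile> a \<Longrightarrow> tautology (Imp a c) \<Longrightarrow> T \<turnstile> c"
  by (blast intro: mp taut)

lemma taut2: "T \<turnstile> a \<Longrightarrow> T \<turnstile> b \<Longrightarrow> tautology (Imp a (Imp b c)) \<Longrightarrow> T \<turnstile> c"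
  by (blast intro: mp taut)

lemma taut3:
  "T \<turnstile> a \<Longrightarrow> T \<turnstile> b \<Longrightarrow> T \<turnstile> c \<Longrightarrow> tautology (Imp a (Imp b (Imp c d))) \<Longrightarrow> T \<turnstile> d"
  by (blast intro: mp taut)

lemma imp_trans: "T \<turnstile> Imp a b \<Longrightarrow> T \<turnstile> Imp b c \<Longrightarrow> T \<turnstile> Imp a c"
  by (rule taut2[of T "Imp a b" "Imp b c"]) (auto simp: tautology_def)

lemma spec_mp: "T \<turnstile> All x \<phi> \<Longrightarrow> free_for t x \<phi> \<Longrightarrow> T \<turnstile> subst \<phi> x t"
  by (blast intro: mp spec)

lemma gen_imp: "T \<turnstile> Imp \<phi> \<psi> \<Longrightarrow> x \<notin> fv \<phi> \<Longrightarrow> T \<turnstile> Imp \<phi> (All x \<psi>)"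
  by (blast intro: mp dist gen)

lemma ex_intro:
  assumes "T \<turnstile> subst \<phi> x t" "free_for t x \<phi>"
  shows "T \<turnstile> Ex x \<phi>"
proof -
  have "T \<turnstile> Imp (All x (Neg \<phi>)) (subst (Neg \<phi>) x t)"
    using assms(2) by (intro spec) simp
  then show ?thesis
    using assms(1) by (rule taut2) (auto simp: tautology_def)
qed

lemma eq_sym: "T \<turnstile> Imp (Eq s t) (Eq t s)"
proof -
  obtain z where z: "z \<notin> vars s \<union> vars t"
    using ex_new_if_finite[OF infinite_UNIV_nat, of "vars s \<union> vars t"] by auto
  have "T \<turnstile> Imp (Eq s t) (Imp (subst (Eq (Var z) s) z s) (subst (Eq (Var z) s) z t))"
    by (rule eq_subst) auto
  then have "T \<turnstile> Imp (Eq s t) (Imp (Eq s s) (Eq t s))"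
    using z by (simp add: subst_tm_fresh)
  then show ?thesis
    using eq_refl by (rule taut2) (auto simp: tautology_def)
qed

lemma eq_cong:
  assumes "T \<turnstile> Eq s t"
  shows "T \<turnstile> Eq (subst_tm r z s) (subst_tm r z t)"
proof -
  obtain y where y: "y \<notin> vars s \<union> vars t \<union> vars r \<union> {z}"
    using ex_new_if_finite[OF infinite_UNIV_nat, of "vars s \<union> vars t \<union> vars r \<union> {z}"] by auto
  \<comment> \<open>\<open>z\<close> may occur in \<open>s\<close> or \<open>t\<close>. Renaming it
    to the fresh \<open>y\<close> makes the Leibniz step act on the right side of the equation
    only.\<close>
  define r' where "r' = subst_tm r z (Var y)"
  have r': "subst_tm r' y w = subst_tm r z w" for w
    using y unfolding r'_def by (induction r) auto
  have fr: "subst_tm (subst_tm r z s) y w = subst_tm r z s" for w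
    using y by (intro subst_tm_fresh)
      (auto simp: subst_tm_eq_msubst_tm vars_msubst_tm split: if_splits)
  have "T \<turnstile> Imp (Eq s t) (Imp (subst (Eq (subst_tm r z s) r') y s) (subst (Eq (subst_tm r z s) r') y t))"
    by (rule eq_subst) auto
  then have "T \<turnstile> Imp (Eq s t) (Imp (Eq (subst_tm r z s) (subst_tm r z s))
      (Eq (subst_tm r z s) (subst_tm r z t)))"
    by (simp add: r' fr)
  then show ?thesis
    using assms eq_refl by (rule taut3) (auto simp: tautology_def)
qed

lemma eq_trans_imp: "T \<turnstile> Imp (Eq r s) (Imp (Eq s t) (Eq r t))"
proof -
  obtain z where z: "z \<notin> vars r"
    using ex_new_if_finite[OF infinite_UNIV_nat, of "vars r"] by auto
  have "T \<turnstile> Imp (Eq s t) (Imp (subst (Eq r (Var z)) z s) (subst (Eq r (Var z)) z t))"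
    by (rule eq_subst) auto
  then have "T \<turnstile> Imp (Eq s t) (Imp (Eq r s) (Eq r t))"
    using z by (simp add: subst_tm_fresh)
  then show ?thesis
    by (rule taut1) (auto simp: tautology_def)
qed

lemma eq_trans: "T \<turnstile> Eq r s \<Longrightarrow> T \<turnstile> Eq s t \<Longrightarrow> T \<turnstile> Eq r t"
  using eq_trans_imp by (blast intro: mp)

lemma eq_Suc: "T \<turnstile> Eq s t \<Longrightarrow> T \<turnstile> Eq (Suc_tm s) (Suc_tm t)"
  using eq_cong[of T s t "Suc_tm (Var 0)" 0] by simp

lemma eq_Plus:
  assumes "T \<turnstile> Eq s t" "T \<turnstile> Eq s' t'"
  shows "T \<turnstile> Eq (Plus s s') (Plus t t')"
proof -
  obtain z where z: "z \<notin> vars s' \<union> vars t"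
    using ex_new_if_finite[OF infinite_UNIV_nat, of "vars s' \<union> vars t"] by auto
  have "T \<turnstile> Eq (Plus s s') (Plus t s')"
    using eq_cong[OF assms(1), of "Plus (Var z) s'" z] z by (simp add: subst_tm_fresh)
  moreover have "T \<turnstile> Eq (Plus t s') (Plus t t')"
    using eq_cong[OF assms(2), of "Plus t (Var z)" z] z by (simp add: subst_tm_fresh)
  ultimately show ?thesis by (rule eq_trans)
qed

lemma eq_Times:
  assumes "T \<turnstile> Eq s t" "T \<turnstile> Eq s' t'"
  shows "T \<turnstile> Eq (Times s s') (Times t t')"
proof -
  obtain z where z: "z \<notin> vars s' \<union> vars t"
    using ex_new_if_finite[OF infinite_UNIV_nat, of "vars s' \<union> vars t"] by auto
  have "T \<turnstile> Eq (Times s s') (Times t s')"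
    using eq_cong[OF assms(1), of "Times (Var z) s'" z] z by (simp add: subst_tm_fresh)
  moreover have "T \<turnstile> Eq (Times t s') (Times t t')"
    using eq_cong[OF assms(2), of "Times t (Var z)" z] z by (simp add: subst_tm_fresh)
  ultimately show ?thesis by (rule eq_trans)
qed

lemma eq_replace: "T \<turnstile> Imp (Eq (Var z) (num n)) (Imp (subst \<phi> z (num n)) \<phi>)"
proof -
  have "T \<turnstile> Imp (Eq (num n) (Var z)) (Imp (subst \<phi> z (num n)) (subst \<phi> z (Var z)))"
    by (rule eq_subst) auto
  with eq_sym[of T "Var z" "num n"] show ?thesis
    by (simp add: imp_trans)
qed

lemma eq_instance: "T \<turnstile> Imp (Eq (Var z) (num n)) (Imp \<phi> (subst \<phi> z (num n)))"
  using eq_subst[of "Var z" z \<phi> "num n" T] by simp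

section \<open>Relations decided by an extension of R\<close>

text \<open>The variable 1 is reserved as the bound variable of \<open>Le\<close>, so that every instance
  used below is a substitution instance of the corresponding axiom of R.\<close>

abbreviation Le :: "tm \<Rightarrow> tm \<Rightarrow> fm" where
  "Le s t \<equiv> Ex 1 (Eq (Plus (Var 1) s) t)"

lemma Leq_Var_num: "Leq (Var 0) (num n) = Le (Var 0) (num n)"
  and Leq_num_Var: "Leq (num n) (Var 0) = Le (num n) (Var 0)"
proof -
  have "(LEAST z. z \<noteq> (0::nat)) = 1" by (rule Least_equality) auto
  then show "Leq (Var 0) (num n) = Le (Var 0) (num n)" "Leq (num n) (Var 0) = Le (num n) (Var 0)"
    by (simp_all add: Leq_def)
qed

section \<open>Evaluation of terms and order facts at numerals\<close>

primrec tval :: "(nat \<Rightarrow> nat) \<Rightarrow> tm \<Rightarrow> nat" where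
  "tval \<sigma> (Var n) = \<sigma> n"
| "tval \<sigma> Zero = 0"
| "tval \<sigma> (Suc_tm t) = Suc (tval \<sigma> t)"
| "tval \<sigma> (Plus s t) = tval \<sigma> s + tval \<sigma> t"
| "tval \<sigma> (Times s t) = tval \<sigma> s * tval \<sigma> t"

lemma tval_cong: "(\<And>i. i \<in> vars t \<Longrightarrow> \<sigma> i = \<rho> i) \<Longrightarrow> tval \<sigma> t = tval \<rho> t"
  by (induction t) auto

lemma tval_fresh [simp]: "z \<notin> vars t \<Longrightarrow> tval (\<sigma>(z := n)) t = tval \<sigma> t"
  by (rule tval_cong) auto

locale R_extension =
  fixes T :: "fm set"
  assumes extends_R: "extends_R T"
begin

lemma axR: "\<phi> \<in> R_axioms \<Longrightarrow> T \<turnstile> \<phi>"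
  using extends_R by (auto simp: extends_R_def)

lemma eq_tval: "T \<turnstile> Eq (msubst_tm (\<lambda>i. num (\<sigma> i)) t) (num (tval \<sigma> t))"
proof (induction t)
  case (Plus s t)
  have "T \<turnstile> Eq (Plus (num (tval \<sigma> s)) (num (tval \<sigma> t))) (num (tval \<sigma> s + tval \<sigma> t))"
    by (intro axR R_axioms.intros)
  with eq_Plus[OF Plus] show ?case by (auto intro: eq_trans)
next
  case (Times s t)
  have "T \<turnstile> Eq (Times (num (tval \<sigma> s)) (num (tval \<sigma> t))) (num (tval \<sigma> s * tval \<sigma> t))"
    by (intro axR R_axioms.intros)
  with eq_Times[OF Times] show ?case by (auto intro: eq_trans)
qed (auto intro: eq_refl eq_Suc)

lemma neq_num: "m \<noteq> n \<Longrightarrow> T \<turnstile> Neg (Eq (num m) (num n))"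
  by (intro axR R_axioms.intros)

lemma Le_imp_eq_some:
  assumes "z \<noteq> 1"
  shows "T \<turnstile> Imp (Le (Var z) (num n)) (eq_some_upto (Var z) n)"
proof -
  have ff: "free_for (Var z) 0 (eq_some_upto (Var 0) n)"
    and sb: "subst (eq_some_upto (Var 0) n) 0 (Var z) = eq_some_upto (Var z) n"
    by (induction n) auto
  have "T \<turnstile> All 0 (Imp (Le (Var 0) (num n)) (eq_some_upto (Var 0) n))"
    unfolding Leq_Var_num[symmetric] by (intro axR R_axioms.intros)
  from spec_mp[OF this, of "Var z"] show ?thesis
    using assms by (simp add: ff sb)
qed

lemma Le_total:
  assumes "z \<noteq> 1"
  shows "T \<turnstile> Dis (Le (Var z) (num n)) (Le (num n) (Var z))"
proof -
  have "T \<turnstile> All 0 (Dis (Le (Var 0) (num n)) (Le (num n) (Var 0)))"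
    unfolding Leq_Var_num[symmetric] Leq_num_Var[symmetric] by (intro axR R_axioms.intros)
  from spec_mp[OF this, of "Var z"] show ?thesis
    using assms by simp
qed

text \<open>Below a standard bound R admits only numerals, so a bounded claim about an arbitrary
  element reduces to finitely many numeral instances. No induction inside \<open>T\<close> is
  involved.\<close>

lemma Le_cases:
  assumes "z \<noteq> 1" "\<And>k. k \<le> n \<Longrightarrow> T \<turnstile> subst \<phi> z (num k)"
  shows "T \<turnstile> Imp (Le (Var z) (num n)) \<phi>"
proof -
  have *: "T \<turnstile> Imp (Eq (Var z) (num k)) \<phi>" if "k \<le> n" for k
    using eq_replace assms(2)[OF that] by (rule taut2) (auto simp: tautology_def)
  have "T \<turnstile> Imp (eq_some_upto (Var z) m) \<phi>" if "m \<le> n" for m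
    using that
  proof (induction m)
    case 0
    then show ?case using *[of 0] by simp
  next
    case (Suc m)
    then have "T \<turnstile> Imp (eq_some_upto (Var z) m) \<phi>" "T \<turnstile> Imp (Eq (Var z) (num (Suc m))) \<phi>"
      using *[of "Suc m"] by auto
    then show ?case by (rule taut2) (auto simp: tautology_def)
  qed
  with Le_imp_eq_some[OF assms(1)] show ?thesis by (blast intro: imp_trans)
qed

lemma Le_num: "k \<le> n \<Longrightarrow> T \<turnstile> Le (num k) (num n)"
  using axR[OF R_axioms.intros(1)[of "n - k" k]]
  by (intro ex_intro[where t = "num (n - k)"]) auto

text \<open>R has no axiom that refutes an inequality outright. Everything below
  \<open>num n\<close> is one of finitely many numerals, each provably different from
  \<open>num k\<close>; the claim is the instance at \<open>num k\<close> itself.\<close>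

lemma not_Le_num:
  assumes "n < k"
  shows "T \<turnstile> Neg (Le (num k) (num n))"
proof -
  have "T \<turnstile> Imp (Le (Var 2) (num n)) (Neg (Eq (Var 2) (num k)))"
    using assms by (intro Le_cases) (auto intro: neq_num)
  from spec_mp[OF gen[OF this], of "num k" 2]
  have "T \<turnstile> Imp (Le (num k) (num n)) (Neg (Eq (num k) (num k)))"
    by simp
  then show ?thesis
    using eq_refl by (rule taut2) (auto simp: tautology_def)
qed

text \<open>Numeralwise representability. Values are given to all variables, not to a chosen tuple,
  so that connectives and quantifiers combine without tracking which variables are free.\<close>

definition rep :: "fm \<Rightarrow> ((nat \<Rightarrow> nat) \<Rightarrow> bool) \<Rightarrow> bool" where
  "rep A P \<longleftrightarrow> (\<forall>\<sigma>. if P \<sigma> then T \<turnstile> msubst (\<lambda>i. num (\<sigma> i)) A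
      else T \<turnstile> Neg (msubst (\<lambda>i. num (\<sigma> i)) A))"

lemma rep_true: "rep A P \<Longrightarrow> P \<sigma> \<Longrightarrow> T \<turnstile> msubst (\<lambda>i. num (\<sigma> i)) A"
  and rep_false: "rep A P \<Longrightarrow> \<not> P \<sigma> \<Longrightarrow> T \<turnstile> Neg (msubst (\<lambda>i. num (\<sigma> i)) A)"
  by (metis rep_def)+

lemma rep_Eq: "rep (Eq s t) (\<lambda>\<sigma>. tval \<sigma> s = tval \<sigma> t)"
  unfolding rep_def
proof (intro allI)
  fix \<sigma>
  let ?s = "msubst_tm (\<lambda>i. num (\<sigma> i)) s" and ?t = "msubst_tm (\<lambda>i. num (\<sigma> i)) t"
  have s: "T \<turnstile> Eq (num (tval \<sigma> s)) ?s" and t: "T \<turnstile> Eq ?t (num (tval \<sigma> t))"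
    using eq_tval eq_sym by (blast intro: mp)+
  show "if tval \<sigma> s = tval \<sigma> t then T \<turnstile> msubst (\<lambda>i. num (\<sigma> i)) (Eq s t)
      else T \<turnstile> Neg (msubst (\<lambda>i. num (\<sigma> i)) (Eq s t))"
  proof (cases "tval \<sigma> s = tval \<sigma> t")
    case True
    then have "T \<turnstile> Eq ?s (num (tval \<sigma> t))" "T \<turnstile> Eq (num (tval \<sigma> t)) ?t"
      using eq_tval[of \<sigma> s] eq_tval[of \<sigma> t] eq_sym by (metis mp)+
    with True show ?thesis by (auto intro: eq_trans)
  next
    case False
    have "T \<turnstile> Imp (Eq ?s ?t) (Eq (num (tval \<sigma> s)) ?t)"
      using s eq_trans_imp by (rule mp[rotated])
    moreover have "T \<turnstile> Imp (Eq (num (tval \<sigma> s)) ?t) (Eq (num (tval \<sigma> s)) (num (tval \<sigma> t)))"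
      using t eq_trans_imp[of T "num (tval \<sigma> s)" ?t "num (tval \<sigma> t)"]
      by (rule taut2) (auto simp: tautology_def)
    moreover have "T \<turnstile> Neg (Eq (num (tval \<sigma> s)) (num (tval \<sigma> t)))"
      by (rule neq_num[OF False])
    ultimately have "T \<turnstile> Neg (Eq ?s ?t)"
      by (rule taut3[where d = "Neg (Eq ?s ?t)"]) (auto simp: tautology_def)
    with False show ?thesis by simp
  qed
qed

lemma rep_Neg: "rep A P \<Longrightarrow> rep (Neg A) (\<lambda>\<sigma>. \<not> P \<sigma>)"
proof -
  have "T \<turnstile> Neg (Neg a)" if "T \<turnstile> a" for a
    using that by (rule taut1) (auto simp: tautology_def)
  then show "rep A P \<Longrightarrow> rep (Neg A) (\<lambda>\<sigma>. \<not> P \<sigma>)"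
    by (simp add: rep_def)
qed

lemma rep_Con:
  assumes A: "rep A P" and B: "rep B Q"
  shows "rep (Con A B) (\<lambda>\<sigma>. P \<sigma> \<and> Q \<sigma>)"
  unfolding rep_def
proof (intro allI)
  fix \<sigma>
  let ?A = "msubst (\<lambda>i. num (\<sigma> i)) A" and ?B = "msubst (\<lambda>i. num (\<sigma> i)) B"
  have "T \<turnstile> Con ?A ?B" if "P \<sigma>" "Q \<sigma>"
    using rep_true[OF A, OF that(1)] rep_true[OF B, OF that(2)]
    by (rule taut2) (auto simp: tautology_def)
  moreover have "T \<turnstile> Neg (Con ?A ?B)" if "\<not> P \<sigma>"
    using rep_false[OF A, OF that] by (rule taut1) (auto simp: tautology_def)
  moreover have "T \<turnstile> Neg (Con ?A ?B)" if "\<not> Q \<sigma>"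
    using rep_false[OF B, OF that] by (rule taut1) (auto simp: tautology_def)
  ultimately show "if P \<sigma> \<and> Q \<sigma> then T \<turnstile> msubst (\<lambda>i. num (\<sigma> i)) (Con A B)
      else T \<turnstile> Neg (msubst (\<lambda>i. num (\<sigma> i)) (Con A B))"
    by auto
qed

lemma rep_Le:
  assumes "y \<noteq> 1" "u \<noteq> 1"
  shows "rep (Le (Var y) (Var u)) (\<lambda>\<sigma>. \<sigma> y \<le> \<sigma> u)"
  unfolding rep_def using assms Le_num not_Le_num by auto

lemma rep_ball:
  assumes A: "rep A P" and z: "z \<noteq> 1" and y: "y \<noteq> 1" "y \<noteq> z"
  shows "rep (All z (Imp (Le (Var z) (Var y)) A)) (\<lambda>\<sigma>. \<forall>n\<le>\<sigma> y. P (\<sigma>(z := n)))"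
  unfolding rep_def
proof (intro allI)
  fix \<sigma> :: "nat \<Rightarrow> nat"
  \<comment> \<open>The quantified variable stays free, so that numeral instances of
    \<open>A'\<close> are instances of \<open>A\<close> under updated assignments.\<close>
  define A' where "A' = msubst ((\<lambda>i. num (\<sigma> i))(z := Var z)) A"
  have A': "subst A' z (num k) = msubst (\<lambda>i. num ((\<sigma>(z := k)) i)) A" for k
    unfolding A'_def
    by (subst subst_msubst) (auto intro!: arg_cong[where f = "\<lambda>\<tau>. msubst \<tau> A"])
  have eq: "msubst (\<lambda>i. num (\<sigma> i)) (All z (Imp (Le (Var z) (Var y)) A))
      = All z (Imp (Le (Var z) (num (\<sigma> y))) A')"
    using z y by (simp add: A'_def)
  have "T \<turnstile> All z (Imp (Le (Var z) (num (\<sigma> y))) A')" if "\<forall>n\<le>\<sigma> y. P (\<sigma>(z := n))"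
  proof (intro gen Le_cases[OF z])
    show "T \<turnstile> subst A' z (num k)" if "k \<le> \<sigma> y" for k
      unfolding A' using \<open>\<forall>n\<le>\<sigma> y. P (\<sigma>(z := n))\<close> that
      by (intro rep_true[OF A, of "\<sigma>(z := k)"]) auto
  qed
  moreover have "T \<turnstile> Neg (All z (Imp (Le (Var z) (num (\<sigma> y))) A'))"
    if k: "k \<le> \<sigma> y" "\<not> P (\<sigma>(z := k))" for k
  proof -
    have "T \<turnstile> Imp (All z (Imp (Le (Var z) (num (\<sigma> y))) A'))
        (subst (Imp (Le (Var z) (num (\<sigma> y))) A') z (num k))"
      by (rule spec) (simp only: free_for_num)
    moreover have "subst (Imp (Le (Var z) (num (\<sigma> y))) A') z (num k)
        = Imp (Le (num k) (num (\<sigma> y))) (msubst (\<lambda>i. num ((\<sigma>(z := k)) i)) A)"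
      unfolding A'[symmetric] using z by simp
    ultimately have "T \<turnstile> Imp (All z (Imp (Le (Var z) (num (\<sigma> y))) A'))
        (Imp (Le (num k) (num (\<sigma> y))) (msubst (\<lambda>i. num ((\<sigma>(z := k)) i)) A))"
      by simp
    then show ?thesis
      using Le_num[OF k(1)] rep_false[OF A, OF k(2)]
      by (rule taut3) (auto simp: tautology_def)
  qed
  ultimately show "if \<forall>n\<le>\<sigma> y. P (\<sigma>(z := n))
      then T \<turnstile> msubst (\<lambda>i. num (\<sigma> i)) (All z (Imp (Le (Var z) (Var y)) A))
      else T \<turnstile> Neg (msubst (\<lambda>i. num (\<sigma> i)) (All z (Imp (Le (Var z) (Var y)) A)))"
    unfolding eq by auto
qed

text \<open>A formula obtained through the closure rules may have stray free variables. Replacing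
  those outside \<open>V\<close> by \<open>Zero\<close> removes them, at the price of evaluating
  \<open>P\<close> with these coordinates set to 0.\<close>

lemma rep_restrict:
  assumes "rep A P"
  obtains B where "fv B \<subseteq> V" "rep B (\<lambda>\<sigma>. P (\<lambda>i. if i \<in> V then \<sigma> i else 0))"
proof
  let ?\<tau> = "\<lambda>i. if i \<in> V then Var i else Zero"
  have t: "tame ?\<tau>" by (auto simp: tame_def)
  have *: "msubst (\<lambda>i. num (\<sigma> i)) (msubst ?\<tau> A)
      = msubst (\<lambda>i. num (if i \<in> V then \<sigma> i else 0)) A" for \<sigma>
    unfolding msubst_msubst[OF t] by (intro msubst_cong) auto
  show "fv (msubst ?\<tau> A) \<subseteq> V"
    by (auto simp: fv_msubst[OF t] split: if_splits)
  show "rep (msubst ?\<tau> A) (\<lambda>\<sigma>. P (\<lambda>i. if i \<in> V then \<sigma> i else 0))"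
    using assms by (simp add: rep_def *)
qed

section \<open>Decided predicates and existential predicates of assignments\<close>

definition dec :: "((nat \<Rightarrow> nat) \<Rightarrow> bool) \<Rightarrow> bool" where
  "dec P \<longleftrightarrow> (\<exists>A. rep A P)"

lemma dec_eq: "dec (\<lambda>\<sigma>. tval \<sigma> s = tval \<sigma> t)"
  and dec_not: "dec P \<Longrightarrow> dec (\<lambda>\<sigma>. \<not> P \<sigma>)"
  and dec_conj: "dec P \<Longrightarrow> dec Q \<Longrightarrow> dec (\<lambda>\<sigma>. P \<sigma> \<and> Q \<sigma>)"
  and dec_ball: "dec P \<Longrightarrow> z \<noteq> 1 \<Longrightarrow> y \<noteq> 1 \<Longrightarrow> y \<noteq> z \<Longrightarrow> dec (\<lambda>\<sigma>. \<forall>n\<le>\<sigma> y. P (\<sigma>(z := n)))"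
  unfolding dec_def by (blast intro: rep_Eq rep_Neg rep_Con dest: rep_ball)+

lemma dec_disj: "dec P \<Longrightarrow> dec Q \<Longrightarrow> dec (\<lambda>\<sigma>. P \<sigma> \<or> Q \<sigma>)"
  using dec_not[OF dec_conj[OF dec_not dec_not]] by simp

lemma dec_bex: "dec P \<Longrightarrow> z \<noteq> 1 \<Longrightarrow> y \<noteq> 1 \<Longrightarrow> y \<noteq> z \<Longrightarrow> dec (\<lambda>\<sigma>. \<exists>n\<le>\<sigma> y. P (\<sigma>(z := n)))"
  using dec_not[OF dec_ball[OF dec_not]] by simp

text \<open>Variable 2 carries the witness of an existential statement.  As the matrices are monotone in
  it, one variable can serve all quantifiers at once.\<close>

definition sig :: "((nat \<Rightarrow> nat) \<Rightarrow> bool) \<Rightarrow> bool" where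
  "sig P \<longleftrightarrow> (\<exists>Q. dec Q \<and> (\<forall>\<sigma> w w'. Q (\<sigma>(2 := w)) \<longrightarrow> w \<le> w' \<longrightarrow> Q (\<sigma>(2 := w'))) \<and>
     (\<forall>\<sigma>. P \<sigma> \<longleftrightarrow> (\<exists>w. Q (\<sigma>(2 := w)))))"

lemma sigI:
  assumes "dec Q" "\<And>\<sigma> w w'. Q (\<sigma>(2 := w)) \<Longrightarrow> w \<le> w' \<Longrightarrow> Q (\<sigma>(2 := w'))"
    "\<And>\<sigma>. P \<sigma> \<longleftrightarrow> (\<exists>w. Q (\<sigma>(2 := w)))"
  shows "sig P"
  using assms unfolding sig_def by blast

lemma sig_cong: "sig P \<Longrightarrow> (\<And>\<sigma>. P \<sigma> \<longleftrightarrow> Q \<sigma>) \<Longrightarrow> sig Q"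
  by (subgoal_tac "P = Q") auto

lemma sig_eq:
  assumes "vars s \<subseteq> {3..}" "vars t \<subseteq> {3..}"
  shows "sig (\<lambda>\<sigma>. tval \<sigma> s = tval \<sigma> t)"
proof (rule sigI[OF dec_eq])
  have "2 \<notin> vars s" "2 \<notin> vars t" using assms by auto
  then show "tval (\<sigma>(2 := w)) s = tval (\<sigma>(2 := w)) t \<Longrightarrow> tval (\<sigma>(2 := w')) s = tval (\<sigma>(2 := w')) t"
    "tval \<sigma> s = tval \<sigma> t \<longleftrightarrow> (\<exists>w. tval (\<sigma>(2 := w)) s = tval (\<sigma>(2 := w)) t)" for \<sigma> w w'
    by auto
qed

text \<open>By monotonicity the larger of two witnesses serves both conjuncts.\<close>

lemma sig_conj:
  assumes "sig P" "sig P'"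
  shows "sig (\<lambda>\<sigma>. P \<sigma> \<and> P' \<sigma>)"
proof -
  obtain Q where Q: "dec Q" "\<And>\<sigma> w w'. Q (\<sigma>(2 := w)) \<Longrightarrow> w \<le> w' \<Longrightarrow> Q (\<sigma>(2 := w'))"
    "\<And>\<sigma>. P \<sigma> \<longleftrightarrow> (\<exists>w. Q (\<sigma>(2 := w)))"
    using assms(1) unfolding sig_def by blast
  obtain Q' where Q': "dec Q'" "\<And>\<sigma> w w'. Q' (\<sigma>(2 := w)) \<Longrightarrow> w \<le> w' \<Longrightarrow> Q' (\<sigma>(2 := w'))"
    "\<And>\<sigma>. P' \<sigma> \<longleftrightarrow> (\<exists>w. Q' (\<sigma>(2 := w)))"
    using assms(2) unfolding sig_def by blast
  show ?thesis
  proof (rule sigI[OF dec_conj[OF Q(1) Q'(1)]])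
    fix \<sigma>
    show "P \<sigma> \<and> P' \<sigma> \<longleftrightarrow> (\<exists>w. Q (\<sigma>(2 := w)) \<and> Q' (\<sigma>(2 := w)))"
      unfolding Q(3) Q'(3) by (meson Q(2) Q'(2) nat_le_linear)
  qed (use Q(2) Q'(2) in blast)
qed

lemma sig_disj:
  assumes "sig P" "sig P'"
  shows "sig (\<lambda>\<sigma>. P \<sigma> \<or> P' \<sigma>)"
proof -
  obtain Q where Q: "dec Q" "\<And>\<sigma> w w'. Q (\<sigma>(2 := w)) \<Longrightarrow> w \<le> w' \<Longrightarrow> Q (\<sigma>(2 := w'))"
    "\<And>\<sigma>. P \<sigma> \<longleftrightarrow> (\<exists>w. Q (\<sigma>(2 := w)))"
    using assms(1) unfolding sig_def by blast
  obtain Q' where Q': "dec Q'" "\<And>\<sigma> w w'. Q' (\<sigma>(2 := w)) \<Longrightarrow> w \<le> w' \<Longrightarrow> Q' (\<sigma>(2 := w'))"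
    "\<And>\<sigma>. P' \<sigma> \<longleftrightarrow> (\<exists>w. Q' (\<sigma>(2 := w)))"
    using assms(2) unfolding sig_def by blast
  show ?thesis
    by (rule sigI[OF dec_disj[OF Q(1) Q'(1)]]) (use Q(2,3) Q'(2,3) in blast)+
qed

text \<open>The witness variable also bounds the quantified value, which turns the unbounded
  quantifier into a bounded one. From a value \<open>n\<close> with witness \<open>w\<close>, the
  number \<open>max n w\<close> plays both roles.\<close>

lemma sig_ex:
  assumes "sig P" "3 \<le> z"
  shows "sig (\<lambda>\<sigma>. \<exists>n. P (\<sigma>(z := n)))"
proof -
  obtain Q where Q: "dec Q" "\<And>\<sigma> w w'. Q (\<sigma>(2 := w)) \<Longrightarrow> w \<le> w' \<Longrightarrow> Q (\<sigma>(2 := w'))"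
    "\<And>\<sigma>. P \<sigma> \<longleftrightarrow> (\<exists>w. Q (\<sigma>(2 := w)))"
    using assms(1) unfolding sig_def by blast
  have twist: "\<sigma>(2 := w, z := n) = \<sigma>(z := n, 2 := w)" for \<sigma> :: "nat \<Rightarrow> nat" and w n
    using assms(2) by (intro fun_upd_twist) auto
  show ?thesis
  proof (rule sigI[OF dec_bex[OF Q(1), of z 2]])
    fix \<sigma> w w'
    show "\<exists>n\<le>(\<sigma>(2 := w')) 2. Q (\<sigma>(2 := w', z := n))"
      if "\<exists>n\<le>(\<sigma>(2 := w)) 2. Q (\<sigma>(2 := w, z := n))" "w \<le> w'"
    proof -
      from that obtain n where "n \<le> w" "Q (\<sigma>(z := n, 2 := w))" by (auto simp: twist)
      with that(2) have "n \<le> w'" "Q (\<sigma>(z := n, 2 := w'))" using Q(2) by auto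
      then show ?thesis by (auto simp: twist)
    qed
    show "(\<exists>n. P (\<sigma>(z := n))) \<longleftrightarrow> (\<exists>w. \<exists>n\<le>(\<sigma>(2 := w)) 2. Q (\<sigma>(2 := w, z := n)))"
    proof
      assume "\<exists>n. P (\<sigma>(z := n))"
      then obtain n w where "Q (\<sigma>(z := n, 2 := w))" by (auto simp: Q(3))
      then have "Q (\<sigma>(z := n, 2 := max n w))" by (rule Q(2)) simp
      then have "\<exists>n'\<le>(\<sigma>(2 := max n w)) 2. Q (\<sigma>(2 := max n w, z := n'))"
        by (intro exI[of _ n]) (simp add: twist)
      then show "\<exists>w. \<exists>n\<le>(\<sigma>(2 := w)) 2. Q (\<sigma>(2 := w, z := n))" ..
    qed (auto simp: twist Q(3))
  qed (use assms(2) in auto)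
qed

text \<open>Collection: finitely many witnesses have a maximum. It is applied to standard numbers
  only, so the induction takes place outside \<open>T\<close>.\<close>

lemma bounded_witness:
  assumes "\<And>n w w' :: nat. R n w \<Longrightarrow> w \<le> w' \<Longrightarrow> R n w'"
  shows "\<forall>n\<le>k :: nat. \<exists>w. R n w \<Longrightarrow> \<exists>w. \<forall>n\<le>k. R n w"
proof (induction k)
  case (Suc k)
  then obtain w w' where "\<forall>n\<le>k. R n w" "R (Suc k) w'" by auto
  then have "\<forall>n\<le>Suc k. R n (max w w')"
    by (metis assms le_SucE max.cobounded1 max.cobounded2)
  then show ?case ..
qed auto

lemma sig_ball:
  assumes "sig P" "3 \<le> z" "3 \<le> y" "y \<noteq> z"
  shows "sig (\<lambda>\<sigma>. \<forall>n\<le>\<sigma> y. P (\<sigma>(z := n)))"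
proof -
  obtain Q where Q: "dec Q" "\<And>\<sigma> w w'. Q (\<sigma>(2 := w)) \<Longrightarrow> w \<le> w' \<Longrightarrow> Q (\<sigma>(2 := w'))"
    "\<And>\<sigma>. P \<sigma> \<longleftrightarrow> (\<exists>w. Q (\<sigma>(2 := w)))"
    using assms(1) unfolding sig_def by blast
  have twist: "\<sigma>(2 := w, z := n) = \<sigma>(z := n, 2 := w)" for \<sigma> :: "nat \<Rightarrow> nat" and w n
    using assms(2) by (intro fun_upd_twist) auto
  have y: "(\<sigma>(2 := w)) y = \<sigma> y" for \<sigma> :: "nat \<Rightarrow> nat" and w
    using assms(3) by auto
  show ?thesis
  proof (rule sigI[OF dec_ball[OF Q(1), of z y]])
    fix \<sigma> w w'
    show "\<forall>n\<le>(\<sigma>(2 := w')) y. Q (\<sigma>(2 := w', z := n))"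
      if "\<forall>n\<le>(\<sigma>(2 := w)) y. Q (\<sigma>(2 := w, z := n))" "w \<le> w'"
      using that Q(2) unfolding twist y by blast
    have "\<exists>w. \<forall>n\<le>\<sigma> y. Q (\<sigma>(z := n, 2 := w))" if "\<forall>n\<le>\<sigma> y. \<exists>w. Q (\<sigma>(z := n, 2 := w))"
      using Q(2) that by (rule bounded_witness)
    then show "(\<forall>n\<le>\<sigma> y. P (\<sigma>(z := n)))
        \<longleftrightarrow> (\<exists>w. \<forall>n\<le>(\<sigma>(2 := w)) y. Q (\<sigma>(2 := w, z := n)))"
      unfolding twist y Q(3) by blast
  qed (use assms in auto)
qed

end

section \<open>The beta function\<close>

text \<open>Goedel's beta function, which codes finite sequences with addition and multiplication
  alone.\<close>

definition beta :: "nat \<Rightarrow> nat \<Rightarrow> nat \<Rightarrow> nat" where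
  "beta a b i = a mod Suc (Suc i * b)"

text \<open>\<open>q\<close> is the quotient, and the slack \<open>s\<close> expresses that the
  remainder is below the modulus. Only equations between terms remain, the form accepted by
  \<open>sig_eq\<close>.\<close>

lemma beta_eq_iff:
  "beta a b i = r \<longleftrightarrow> (\<exists>q s. a = q * Suc (Suc i * b) + r \<and> r + s = Suc i * b)"
proof
  assume "beta a b i = r"
  then have r: "a = a div Suc (Suc i * b) * Suc (Suc i * b) + r" "r < Suc (Suc i * b)"
    unfolding beta_def by (metis div_mult_mod_eq, metis mod_less_divisor zero_less_Suc)
  have "r + (Suc i * b - r) = Suc i * b"
    using r(2) by (simp only: less_Suc_eq_le le_add_diff_inverse)
  with r(1) show "\<exists>q s. a = q * Suc (Suc i * b) + r \<and> r + s = Suc i * b"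
    by blast
next
  assume "\<exists>q s. a = q * Suc (Suc i * b) + r \<and> r + s = Suc i * b"
  then obtain q s where a: "a = q * Suc (Suc i * b) + r" and "r + s = Suc i * b" by blast
  then have "r < Suc (Suc i * b)" by linarith
  then show "beta a b i = r"
    by (simp add: beta_def a del: mult_Suc mult_Suc_right)
qed

text \<open>Chinese remaindering with the moduli \<open>Suc (Suc i * b)\<close>, which are pairwise
  coprime because \<open>b\<close> is a factorial divisible by every difference of indices.\<close>

lemma beta_codes_sequence: "\<exists>a b. \<forall>i\<le>n. beta a b i = s i"
proof -
  \<comment> \<open>\<open>M\<close> is at least \<open>n\<close>, so that every
    \<open>j - i\<close> divides \<open>fact M\<close>, and at least every \<open>s i\<close>, so
    that \<open>s i\<close> is smaller than its modulus.\<close>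
  define M where "M = n + Max (s ` {..n})"
  define b :: nat where "b = fact M"
  have sb: "s i \<le> b" if "i \<le> n" for i
  proof -
    have "s i \<le> Max (s ` {..n})" using that by (intro Max_ge) auto
    also have "\<dots> \<le> M" by (simp add: M_def)
    also have "\<dots> \<le> b" unfolding b_def by (rule fact_ge_self)
    finally show ?thesis .
  qed
  have cop: "coprime (Suc (Suc i * b)) (Suc (Suc j * b))" if "i < j" "j \<le> n" for i j
  proof (rule coprimeI)
    fix d
    assume d: "d dvd Suc (Suc i * b)" "d dvd Suc (Suc j * b)"
    \<comment> \<open>This combination of the two moduli cancels \<open>b\<close>, so a common
      divisor divides \<open>j - i\<close>, hence \<open>b\<close>, hence 1.\<close>
    have "Suc j * Suc (Suc i * b) - Suc i * Suc (Suc j * b) = j - i"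
      by (simp add: algebra_simps)
    then have "d dvd j - i"
      using d by (metis dvd_diff_nat dvd_mult)
    moreover have "j - i dvd b"
      unfolding b_def using that by (intro dvd_fact) (auto simp: M_def)
    ultimately have "d dvd Suc i * b"
      by (meson dvd_mult dvd_trans)
    with d(1) show "is_unit d"
      using dvd_diff_nat[of d "Suc (Suc i * b)" "Suc i * b"] by simp
  qed
  have "\<exists>a. \<forall>i\<in>{..n}. [a = s i] (mod Suc (Suc i * b))"
  proof (rule chinese_remainder_nat)
    show "\<forall>i\<in>{..n}. \<forall>j\<in>{..n}. i \<noteq> j \<longrightarrow> coprime (Suc (Suc i * b)) (Suc (Suc j * b))"
      using cop by (metis atMost_iff coprime_commute linorder_neqE_nat)
  qed simp
  then obtain a where a: "\<And>i. i \<le> n \<Longrightarrow> [a = s i] (mod Suc (Suc i * b))" by auto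
  have "beta a b i = s i" if "i \<le> n" for i
  proof -
    have "s i < Suc (Suc i * b)" using sb[OF that] by simp
    with a[OF that] show ?thesis by (simp add: cong_def beta_def del: mult_Suc)
  qed
  then show ?thesis by blast
qed

section \<open>Graphs of partial recursive functions\<close>

text \<open>A positive description of minimisation: earlier values exist and are successors. Without
  any mention of divergence or of \<open>LEAST\<close>, the graph remains existential.\<close>

lemma run_Mu_eq_Some:
  "run (Mu f) xs = Some y \<longleftrightarrow>
    run f (y # xs) = Some 0 \<and> (\<forall>m<y. \<exists>r. run f (m # xs) = Some (Suc r))"
proof
  assume h: "run (Mu f) xs = Some y"
  then obtain n where n: "run f (n # xs) = Some 0" "\<forall>m<n. run f (m # xs) \<noteq> None"
    and y: "y = (LEAST n. run f (n # xs) = Some 0)"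
    by (auto split: if_splits)
  have "run f (y # xs) = Some 0" unfolding y using n(1) by (rule LeastI)
  moreover have "y \<le> n" unfolding y using n(1) by (rule Least_le)
  moreover have "run f (m # xs) \<noteq> Some 0" if "m < y" for m
    using that unfolding y by (rule not_less_Least)
  ultimately show "run f (y # xs) = Some 0 \<and> (\<forall>m<y. \<exists>r. run f (m # xs) = Some (Suc r))"
    using n(2) by (metis less_le_trans not0_implies_Suc option.exhaust)
next
  assume h: "run f (y # xs) = Some 0 \<and> (\<forall>m<y. \<exists>r. run f (m # xs) = Some (Suc r))"
  then have "(LEAST n. run f (n # xs) = Some 0) = y"
    by (intro Least_equality) (auto, metis Zero_not_Suc not_le_imp_less option.inject)
  moreover have "\<exists>n. run f (n # xs) = Some 0 \<and> (\<forall>m<n. run f (m # xs) \<noteq> None)"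
    using h by (intro exI[of _ y]) fastforce
  ultimately show "run (Mu f) xs = Some y" by simp
qed

lemma run_PrimRec_eq_Some:
  "run (PrimRec f g) (n # xs) = Some y \<longleftrightarrow>
    (\<exists>s. run f xs = Some (s 0) \<and> (\<forall>i<n. run g (i # s i # xs) = Some (s (Suc i))) \<and> s n = y)"
proof (induction n arbitrary: y)
  case 0
  show ?case by (auto intro: exI[of _ "\<lambda>_. y"])
next
  case (Suc n)
  have "run (PrimRec f g) (Suc n # xs) = Some y \<longleftrightarrow>
      (\<exists>z. run (PrimRec f g) (n # xs) = Some z \<and> run g (n # z # xs) = Some y)"
    by (auto split: option.splits)
  also have "\<dots> \<longleftrightarrow> (\<exists>s. run f xs = Some (s 0)
      \<and> (\<forall>i<Suc n. run g (i # s i # xs) = Some (s (Suc i))) \<and> s (Suc n) = y)"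
    (is "?L \<longleftrightarrow> ?R")
  proof
    assume ?L
    then obtain s where "run f xs = Some (s 0)" "\<forall>i<n. run g (i # s i # xs) = Some (s (Suc i))"
      "run g (n # s n # xs) = Some y"
      unfolding Suc.IH by auto
    then show ?R by (intro exI[of _ "s(Suc n := y)"]) (auto simp: less_Suc_eq)
  next
    assume ?R
    then obtain s where s: "run f xs = Some (s 0)"
      "\<forall>i<Suc n. run g (i # s i # xs) = Some (s (Suc i))" "s (Suc n) = y"
      by blast
    then show ?L unfolding Suc.IH by (intro exI[of _ "s n"] conjI exI[of _ s]) auto
  qed
  finally show ?case .
qed

text \<open>The history of a recursion matters only up to \<open>n\<close>, so two numbers can
  replace the sequence, and quantification over functions becomes quantification over
  numbers.\<close>

lemma run_PrimRec_beta:
  "run (PrimRec f g) (n # xs) = Some y \<longleftrightarrow>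
    (\<exists>a b. run f xs = Some (beta a b 0) \<and>
      (\<forall>i<n. run g (i # beta a b i # xs) = Some (beta a b (Suc i))) \<and> beta a b n = y)"
proof
  assume "run (PrimRec f g) (n # xs) = Some y"
  then obtain s where s: "run f xs = Some (s 0)"
    "\<forall>i<n. run g (i # s i # xs) = Some (s (Suc i))" "s n = y"
    unfolding run_PrimRec_eq_Some by blast
  obtain a b where "\<forall>i\<le>n. beta a b i = s i" using beta_codes_sequence by blast
  with s show "\<exists>a b. run f xs = Some (beta a b 0) \<and>
      (\<forall>i<n. run g (i # beta a b i # xs) = Some (beta a b (Suc i))) \<and> beta a b n = y"
    by (intro exI[of _ a] exI[of _ b]) auto
next
  assume "\<exists>a b. run f xs = Some (beta a b 0) \<and>
      (\<forall>i<n. run g (i # beta a b i # xs) = Some (beta a b (Suc i))) \<and> beta a b n = y"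
  then show "run (PrimRec f g) (n # xs) = Some y"
    unfolding run_PrimRec_eq_Some by blast
qed

lemma fresh_var: "finite F \<Longrightarrow> \<exists>z\<ge>3. z \<notin> F" for F :: "nat set"
  using ex_new_if_finite[OF infinite_UNIV_nat, of "F \<union> {..<3}"] by (auto simp: not_less)

section \<open>Existential definability of the graphs\<close>

context R_extension
begin

lemma sig_beta:
  assumes "3 \<le> a" "3 \<le> b" "3 \<le> r" "vars t \<subseteq> {3..}"
  shows "sig (\<lambda>\<sigma>. beta (\<sigma> a) (\<sigma> b) (tval \<sigma> t) = \<sigma> r)"
proof -
  obtain q where q: "q \<ge> 3" "q \<notin> {a, b, r} \<union> vars t"
    using fresh_var[of "{a, b, r} \<union> vars t"] by auto
  obtain s where s: "s \<ge> 3" "s \<notin> {a, b, r, q} \<union> vars t"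
    using fresh_var[of "{a, b, r, q} \<union> vars t"] by auto
  let ?m = "Times (Suc_tm t) (Var b)"
  have "sig (\<lambda>\<sigma>. tval \<sigma> (Var a) = tval \<sigma> (Plus (Times (Var q) (Suc_tm ?m)) (Var r)))"
    "sig (\<lambda>\<sigma>. tval \<sigma> (Plus (Var r) (Var s)) = tval \<sigma> ?m)"
    by (rule sig_eq; use assms q s in auto)+
  from sig_ex[OF sig_ex[OF sig_conj[OF this] s(1)] q(1)] show ?thesis
    by (rule sig_cong) (use q s in \<open>auto simp: beta_eq_iff\<close>)
qed

text \<open>Intermediate values of a computation are stored in fresh variables and then quantified
  away. The variables are generalised in the induction because subprograms read and write different
  ones.\<close>

lemma sig_run: "set vs \<subseteq> {3..} \<Longrightarrow> 3 \<le> y \<Longrightarrow> sig (\<lambda>\<sigma>. run e (map \<sigma> vs) = Some (\<sigma> y))"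
proof (induction e arbitrary: vs y)
  case Zr
  then have "sig (\<lambda>\<sigma>. tval \<sigma> Zero = tval \<sigma> (Var y))" by (intro sig_eq) auto
  then show ?case by (rule sig_cong) auto
next
  case Sc
  show ?case
  proof (cases vs)
    case Nil
    \<comment> \<open>Divergence corresponds to the empty graph, defined by the false equation 0 =
      1.\<close>
    have "sig (\<lambda>\<sigma>. tval \<sigma> Zero = tval \<sigma> (Suc_tm Zero))" by (intro sig_eq) auto
    then show ?thesis by (rule sig_cong) (simp add: Nil)
  next
    case (Cons x xs)
    with Sc have "sig (\<lambda>\<sigma>. tval \<sigma> (Suc_tm (Var x)) = tval \<sigma> (Var y))" by (intro sig_eq) auto
    then show ?thesis by (rule sig_cong) (simp add: Cons)
  qed
next
  case (Proj i)
  show ?case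
  proof (cases "i < length vs")
    case True
    with Proj have "sig (\<lambda>\<sigma>. tval \<sigma> (Var (vs ! i)) = tval \<sigma> (Var y))"
      by (intro sig_eq) (auto dest: nth_mem)
    then show ?thesis by (rule sig_cong) (simp add: True)
  next
    case False
    have "sig (\<lambda>\<sigma>. tval \<sigma> Zero = tval \<sigma> (Suc_tm Zero))" by (intro sig_eq) auto
    then show ?thesis by (rule sig_cong) (simp add: False)
  qed
next
  case (Comp f gs)
  \<comment> \<open>The argument programs are processed one at a time; \<open>us\<close> lists the
    variables that hold the values already computed.\<close>
  have "sig (\<lambda>\<sigma>. \<exists>ns. those (map (\<lambda>g. run g (map \<sigma> vs)) hs) = Some ns
      \<and> run f (map \<sigma> us @ ns) = Some (\<sigma> y))"
    if "set hs \<subseteq> set gs" "set us \<subseteq> {3..}" for hs us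
    using that
  proof (induction hs arbitrary: us)
    case Nil
    show ?case
      by (rule sig_cong[OF Comp.IH(1)[OF Nil(2) Comp.prems(2)]]) simp
  next
    case (Cons h hs)
    obtain z where z: "z \<ge> 3" "z \<notin> set vs \<union> set us \<union> {y}"
      using fresh_var[of "set vs \<union> set us \<union> {y}"] by auto
    have "sig (\<lambda>\<sigma>. run h (map \<sigma> vs) = Some (\<sigma> z))"
      using Cons.prems Comp.prems z by (intro Comp.IH(2)) auto
    moreover have "sig (\<lambda>\<sigma>. \<exists>ns. those (map (\<lambda>g. run g (map \<sigma> vs)) hs) = Some ns
      \<and> run f (map \<sigma> (us @ [z]) @ ns) = Some (\<sigma> y))"
      using Cons.prems z by (intro Cons.IH) auto
    ultimately have "sig (\<lambda>\<sigma>. run h (map \<sigma> vs) = Some (\<sigma> z) \<and>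
      (\<exists>ns. those (map (\<lambda>g. run g (map \<sigma> vs)) hs) = Some ns
      \<and> run f (map \<sigma> (us @ [z]) @ ns) = Some (\<sigma> y)))"
      by (rule sig_conj)
    from sig_ex[OF this z(1)] show ?case
    proof (rule sig_cong)
      fix \<sigma> :: "nat \<Rightarrow> nat"
      have upd: "map (\<sigma>(z := n)) vs = map \<sigma> vs" "map (\<sigma>(z := n)) us = map \<sigma> us"
        "(\<sigma>(z := n)) y = \<sigma> y" for n
        using z by auto
      show "(\<exists>n. run h (map (\<sigma>(z := n)) vs) = Some ((\<sigma>(z := n)) z) \<and>
          (\<exists>ns. those (map (\<lambda>g. run g (map (\<sigma>(z := n)) vs)) hs) = Some ns \<and>
            run f (map (\<sigma>(z := n)) (us @ [z]) @ ns) = Some ((\<sigma>(z := n)) y)))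
        \<longleftrightarrow> (\<exists>ns. those (map (\<lambda>g. run g (map \<sigma> vs)) (h # hs)) = Some ns \<and>
            run f (map \<sigma> us @ ns) = Some (\<sigma> y))"
        unfolding map_append upd fun_upd_same by (auto split: option.splits)
    qed
  qed
  from this[of gs "[]"] show ?case
    by (rule sig_cong) (auto split: option.splits)
next
  case (PrimRec f g)
  show ?case
  proof (cases vs)
    case Nil
    have "sig (\<lambda>\<sigma>. tval \<sigma> Zero = tval \<sigma> (Suc_tm Zero))" by (intro sig_eq) auto
    then show ?thesis by (rule sig_cong) (simp add: Nil)
  next
    case (Cons n xs)
    define F where "F = insert y (set vs)"
    have fin: "finite F" by (simp add: F_def)
    obtain a where a: "a \<ge> 3" "a \<notin> F" using fresh_var[OF fin] by auto
    obtain b where b: "b \<ge> 3" "b \<notin> insert a F" using fresh_var[of "insert a F"] fin by auto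
    obtain i where i: "i \<ge> 3" "i \<notin> {a, b} \<union> F" using fresh_var[of "{a, b} \<union> F"] fin by auto
    obtain r where r: "r \<ge> 3" "r \<notin> {a, b, i} \<union> F"
      using fresh_var[of "{a, b, i} \<union> F"] fin by auto
    obtain r' where r': "r' \<ge> 3" "r' \<notin> {a, b, i, r} \<union> F"
      using fresh_var[of "{a, b, i, r} \<union> F"] fin by auto
    have n: "n \<ge> 3" "n \<in> F" and xs: "set xs \<subseteq> {3..}" "set xs \<subseteq> F" and y: "y \<ge> 3" "y \<in> F"
      using PrimRec.prems Cons by (auto simp: F_def)
    have upd: "map (\<sigma>(z := k)) xs = map \<sigma> xs" if "z \<notin> F" for z k and \<sigma> :: "nat \<Rightarrow> nat"
      using xs(2) that by auto
    have zero: "sig (\<lambda>\<sigma>. run f (map \<sigma> xs) = Some (beta (\<sigma> a) (\<sigma> b) 0))"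
    proof (rule sig_cong[OF sig_ex[OF sig_conj[OF PrimRec.IH(1)[OF xs(1) r(1)]
            sig_beta[OF a(1) b(1) r(1), of Zero]] r(1)]])
      fix \<sigma> :: "nat \<Rightarrow> nat"
      show "(\<exists>n. run f (map (\<sigma>(r := n)) xs) = Some ((\<sigma>(r := n)) r) \<and>
          beta ((\<sigma>(r := n)) a) ((\<sigma>(r := n)) b) (tval (\<sigma>(r := n)) Zero) = (\<sigma>(r := n)) r)
        \<longleftrightarrow> run f (map \<sigma> xs) = Some (beta (\<sigma> a) (\<sigma> b) 0)"
        using r by (auto simp: upd simp del: map_fun_upd)
    qed simp
    have step: "sig (\<lambda>\<sigma>. run g (\<sigma> i # beta (\<sigma> a) (\<sigma> b) (\<sigma> i) # map \<sigma> xs)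
        = Some (beta (\<sigma> a) (\<sigma> b) (Suc (\<sigma> i))))"
    proof (rule sig_cong[OF sig_ex[OF sig_ex[OF sig_conj[OF sig_conj[OF
            sig_beta[OF a(1) b(1) r(1), of "Var i"] sig_beta[OF a(1) b(1) r'(1), of "Suc_tm (Var i)"]]
            PrimRec.IH(2)[of "i # r # xs" r']] r'(1)] r(1)]])
      fix \<sigma> :: "nat \<Rightarrow> nat"
      show "(\<exists>n n'. (beta ((\<sigma>(r := n, r' := n')) a) ((\<sigma>(r := n, r' := n')) b)
              (tval (\<sigma>(r := n, r' := n')) (Var i)) = (\<sigma>(r := n, r' := n')) r \<and>
            beta ((\<sigma>(r := n, r' := n')) a) ((\<sigma>(r := n, r' := n')) b)
              (tval (\<sigma>(r := n, r' := n')) (Suc_tm (Var i))) = (\<sigma>(r := n, r' := n')) r') \<and>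
            run g (map (\<sigma>(r := n, r' := n')) (i # r # xs)) = Some ((\<sigma>(r := n, r' := n')) r'))
        \<longleftrightarrow> run g (\<sigma> i # beta (\<sigma> a) (\<sigma> b) (\<sigma> i) # map \<sigma> xs)
          = Some (beta (\<sigma> a) (\<sigma> b) (Suc (\<sigma> i)))"
        using r r' by (auto simp: upd simp del: map_fun_upd)
    qed (use i r r' xs in auto)
    \<comment> \<open>Only quantifiers bounded by \<open>\<le>\<close> are available, so
      \<open>k < n\<close> is expressed by exempting the case \<open>k = n\<close>.\<close>
    have "sig (\<lambda>\<sigma>. tval \<sigma> (Var i) = tval \<sigma> (Var n))"
      using i n by (intro sig_eq) auto
    from sig_ball[OF sig_disj[OF this step] i(1) n(1)]
    have "sig (\<lambda>\<sigma>. \<forall>k<\<sigma> n. run g (k # beta (\<sigma> a) (\<sigma> b) k # map \<sigma> xs)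
        = Some (beta (\<sigma> a) (\<sigma> b) (Suc k)))"
    proof (rule sig_cong)
      show "n \<noteq> i" using i n by auto
      fix \<sigma> :: "nat \<Rightarrow> nat"
      show "(\<forall>k\<le>\<sigma> n. tval (\<sigma>(i := k)) (Var i) = tval (\<sigma>(i := k)) (Var n) \<or>
            run g ((\<sigma>(i := k)) i # beta ((\<sigma>(i := k)) a) ((\<sigma>(i := k)) b) ((\<sigma>(i := k)) i)
              # map (\<sigma>(i := k)) xs)
            = Some (beta ((\<sigma>(i := k)) a) ((\<sigma>(i := k)) b) (Suc ((\<sigma>(i := k)) i))))
        \<longleftrightarrow> (\<forall>k<\<sigma> n. run g (k # beta (\<sigma> a) (\<sigma> b) k # map \<sigma> xs)
        = Some (beta (\<sigma> a) (\<sigma> b) (Suc k)))"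
        using i n by (auto simp: upd le_less simp del: map_fun_upd)
    qed
    from sig_ex[OF sig_ex[OF sig_conj[OF zero sig_conj[OF this
            sig_beta[OF a(1) b(1) y(1), of "Var n"]]] b(1)] a(1)]
    show ?thesis
    proof (rule sig_cong)
      show "vars (Var n) \<subseteq> {3..}" using n by auto
      fix \<sigma> :: "nat \<Rightarrow> nat"
      show "(\<exists>k l. run f (map (\<sigma>(a := k, b := l)) xs)
            = Some (beta ((\<sigma>(a := k, b := l)) a) ((\<sigma>(a := k, b := l)) b) 0) \<and>
          (\<forall>m<(\<sigma>(a := k, b := l)) n.
            run g (m # beta ((\<sigma>(a := k, b := l)) a) ((\<sigma>(a := k, b := l)) b) m
              # map (\<sigma>(a := k, b := l)) xs)
            = Some (beta ((\<sigma>(a := k, b := l)) a) ((\<sigma>(a := k, b := l)) b) (Suc m))) \<and>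
          beta ((\<sigma>(a := k, b := l)) a) ((\<sigma>(a := k, b := l)) b) (tval (\<sigma>(a := k, b := l)) (Var n))
            = (\<sigma>(a := k, b := l)) y)
        \<longleftrightarrow> run (PrimRec f g) (map \<sigma> vs) = Some (\<sigma> y)"
        unfolding Cons list.map run_PrimRec_beta
        using a b n y by (auto simp: upd simp del: map_fun_upd)
    qed
  qed
next
  case (Mu f)
  obtain z where z: "z \<ge> 3" "z \<notin> insert y (set vs)"
    using fresh_var[of "insert y (set vs)"] by auto
  obtain a where a: "a \<ge> 3" "a \<notin> insert z (insert y (set vs))"
    using fresh_var[of "insert z (insert y (set vs))"] by auto
  have upd: "map (\<sigma>(x := k)) vs = map \<sigma> vs" if "x \<notin> set vs" for x k and \<sigma> :: "nat \<Rightarrow> nat"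
    using that by auto
  \<comment> \<open>With a term as output one can say both that a value is 0 and, using
    \<open>Suc_tm (Var a)\<close> with \<open>a\<close> quantified, that it is defined and
    nonzero.\<close>
  have val: "sig (\<lambda>\<sigma>. run f (\<sigma> x # map \<sigma> vs) = Some (tval \<sigma> t))"
    if t: "vars t \<subseteq> {3..}" and x: "3 \<le> x" for x t
  proof -
    obtain c where c: "c \<ge> 3" "c \<notin> vars t \<union> insert x (set vs)"
      using fresh_var[of "vars t \<union> insert x (set vs)"] by auto
    have "sig (\<lambda>\<sigma>. run f (map \<sigma> (x # vs)) = Some (\<sigma> c))"
      using Mu.prems c x by (intro Mu.IH) auto
    moreover have "sig (\<lambda>\<sigma>. tval \<sigma> (Var c) = tval \<sigma> t)"
      using c t by (intro sig_eq) auto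
    ultimately have "sig (\<lambda>\<sigma>. run f (map \<sigma> (x # vs)) = Some (\<sigma> c) \<and> tval \<sigma> (Var c) = tval \<sigma> t)"
      by (rule sig_conj)
    from sig_ex[OF this c(1)] show ?thesis
      by (rule sig_cong) (use c in \<open>auto simp: upd simp del: map_fun_upd\<close>)
  qed
  have "sig (\<lambda>\<sigma>. tval \<sigma> (Var z) = tval \<sigma> (Var y))"
    using z Mu.prems by (intro sig_eq) auto
  moreover have "sig (\<lambda>\<sigma>. run f (\<sigma> z # map \<sigma> vs) = Some (tval \<sigma> (Suc_tm (Var a))))"
    using z a by (intro val) auto
  ultimately have "sig (\<lambda>\<sigma>. \<forall>k\<le>\<sigma> y. tval (\<sigma>(z := k)) (Var z) = tval (\<sigma>(z := k)) (Var y) \<or>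
      (\<exists>n. run f ((\<sigma>(z := k, a := n)) z # map (\<sigma>(z := k, a := n)) vs)
        = Some (tval (\<sigma>(z := k, a := n)) (Suc_tm (Var a)))))"
    using z a Mu.prems by (intro sig_ball sig_disj sig_ex) auto
  moreover have "sig (\<lambda>\<sigma>. run f (\<sigma> y # map \<sigma> vs) = Some (tval \<sigma> Zero))"
    using Mu.prems by (intro val) auto
  ultimately have "sig (\<lambda>\<sigma>. run f (\<sigma> y # map \<sigma> vs) = Some (tval \<sigma> Zero) \<and>
      (\<forall>k\<le>\<sigma> y. tval (\<sigma>(z := k)) (Var z) = tval (\<sigma>(z := k)) (Var y) \<or>
      (\<exists>n. run f ((\<sigma>(z := k, a := n)) z # map (\<sigma>(z := k, a := n)) vs)
        = Some (tval (\<sigma>(z := k, a := n)) (Suc_tm (Var a))))))"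
    by (intro sig_conj)
  then show ?case
    by (rule sig_cong) (unfold run_Mu_eq_Some,
      use z a in \<open>auto simp: upd le_less simp del: map_fun_upd\<close>)
qed

section \<open>Representation of partial recursive functions in R\<close>

lemma rep_Imp: "rep A P \<Longrightarrow> rep B Q \<Longrightarrow> rep (Imp A B) (\<lambda>\<sigma>. P \<sigma> \<longrightarrow> Q \<sigma>)"
  using rep_Neg[OF rep_Con[OF _ rep_Neg], of A P B Q] by simp

text \<open>Setting all other coordinates to 0 turns the matrix into a relation between witness,
  argument and value alone, which can then be quantified over its witness or over its value.\<close>

lemma graph_matrix:
  assumes "3 \<le> p" "3 \<le> y" "p \<noteq> y"
  shows "\<exists>S. dec (\<lambda>\<sigma>. S (\<sigma> 2) (\<sigma> p) (\<sigma> y)) \<and>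
    (\<forall>w w' m j. S w m j \<longrightarrow> w \<le> w' \<longrightarrow> S w' m j) \<and>
    (\<forall>m j. run e [m] = Some j \<longleftrightarrow> (\<exists>w. S w m j))"
proof -
  obtain Q where Q: "dec Q" "\<And>\<sigma> w w'. Q (\<sigma>(2 := w)) \<Longrightarrow> w \<le> w' \<Longrightarrow> Q (\<sigma>(2 := w'))"
    "\<And>\<sigma>. run e (map \<sigma> [p]) = Some (\<sigma> y) \<longleftrightarrow> (\<exists>w. Q (\<sigma>(2 := w)))"
    using sig_run[of "[p]" y e] assms unfolding sig_def by auto
  define S where "S = (\<lambda>w m j. Q ((\<lambda>_. 0)(p := m, y := j, 2 := w)))"
  obtain A where A: "rep A Q" using Q(1) by (auto simp: dec_def)
  obtain B where "rep B (\<lambda>\<sigma>. Q (\<lambda>i. if i \<in> {p, y, 2} then \<sigma> i else 0))"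
    using rep_restrict[OF A, of "{p, y, 2}"] by blast
  moreover have "(\<lambda>i. if i \<in> {p, y, 2} then \<sigma> i else 0)
      = (\<lambda>_. 0)(p := \<sigma> p, y := \<sigma> y, 2 := \<sigma> 2)" for \<sigma> :: "nat \<Rightarrow> nat"
    by auto
  ultimately have "dec (\<lambda>\<sigma>. S (\<sigma> 2) (\<sigma> p) (\<sigma> y))"
    unfolding dec_def S_def by auto
  moreover have "S w m j \<Longrightarrow> w \<le> w' \<Longrightarrow> S w' m j" for w w' m j
    unfolding S_def by (rule Q(2))
  moreover have "run e [m] = Some j \<longleftrightarrow> (\<exists>w. S w m j)" for m j
    using Q(3)[of "(\<lambda>_. 0)(p := m, y := j)"] assms(3) unfolding S_def by simp
  ultimately show ?thesis by (intro exI[of _ S]) blast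
qed

lemma dec_restrict:
  assumes "dec P" "\<And>\<sigma>. P (\<lambda>i. if i \<in> V then \<sigma> i else 0) = P \<sigma>"
  obtains A where "fv A \<subseteq> V" "rep A P"
proof -
  obtain A where "rep A P" using assms(1) by (auto simp: dec_def)
  then obtain B where "fv B \<subseteq> V" "rep B (\<lambda>\<sigma>. P (\<lambda>i. if i \<in> V then \<sigma> i else 0))"
    by (rule rep_restrict)
  with assms(2) show ?thesis by (intro that) auto
qed

text \<open>Functionality cannot be read off the values at numerals, since a model of R may contain
  nonstandard witnesses.  So the representing formula asks for a bound \<open>u\<close> that is least: a
  nonstandard \<open>u\<close> lies above the standard least bound, which then refutes its minimality.\<close>

lemma function_representable:
  assumes py: "3 \<le> p" "3 \<le> y" "p \<noteq> y"
  shows "\<exists>\<theta>. fv \<theta> \<subseteq> {p, y} \<and> (\<forall>m d. run e [m] = Some d \<longrightarrow>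
    T \<turnstile> subst (subst \<theta> p (num m)) y (num d) \<and>
    T \<turnstile> Imp (subst \<theta> p (num m)) (Eq (Var y) (num d)))"
proof -
  obtain u where u: "u \<ge> 3" "u \<noteq> p" "u \<noteq> y"
    using fresh_var[of "{p, y}"] by auto
  obtain S where S: "dec (\<lambda>\<sigma>. S (\<sigma> 2) (\<sigma> p) (\<sigma> y))"
    "\<And>w w' m j. S w m j \<Longrightarrow> w \<le> w' \<Longrightarrow> S w' m j"
    "\<And>m j. run e [m] = Some j \<longleftrightarrow> (\<exists>w. S w m j)"
    using graph_matrix[OF py, of e] by blast
  have "dec (\<lambda>\<sigma>. \<exists>w\<le>\<sigma> u. S w (\<sigma> p) (\<sigma> y))"
    using dec_bex[OF S(1), of 2 u] py u by simp
  then obtain E where E: "fv E \<subseteq> {p, y, u}" "rep E (\<lambda>\<sigma>. \<exists>w\<le>\<sigma> u. S w (\<sigma> p) (\<sigma> y))"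
    by (rule dec_restrict[where V = "{p, y, u}"]) auto
  have "dec (\<lambda>\<sigma>. \<exists>j\<le>\<sigma> 2. S (\<sigma> 2) (\<sigma> p) j)"
    using dec_bex[OF S(1), of y 2] py by simp
  then obtain C where C: "fv C \<subseteq> {p, 2}" "rep C (\<lambda>\<sigma>. \<exists>j\<le>\<sigma> 2. S (\<sigma> 2) (\<sigma> p) j)"
    by (rule dec_restrict[where V = "{p, 2}"]) auto
  \<comment> \<open>A candidate for \<open>u\<close> bounds some value together with a witness for
    it. \<open>L\<close> states minimality as equality with \<open>u\<close> of every candidate
    below \<open>u\<close>, so that it can be applied at a numeral without strict
    inequalities.\<close>
  define L where "L = All 2 (Imp (Le (Var 2) (Var u)) (Imp C (Eq (Var 2) (Var u))))"
  define F where "F = Con (Le (Var y) (Var u)) (Con E L)"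
  let ?P = "\<lambda>m k j. j \<le> k \<and> (\<exists>w\<le>k. S w m j) \<and> (\<forall>w\<le>k. (\<exists>j\<le>w. S w m j) \<longrightarrow> w = k)"
  have fvF: "fv F \<subseteq> {p, y, u}"
    using E(1) C(1) by (auto simp: F_def L_def)
  have "rep F (\<lambda>\<sigma>. \<sigma> y \<le> \<sigma> u \<and> (\<exists>w\<le>\<sigma> u. S w (\<sigma> p) (\<sigma> y)) \<and>
      (\<forall>w\<le>\<sigma> u. (\<exists>j\<le>(\<sigma>(2 := w)) 2. S ((\<sigma>(2 := w)) 2) ((\<sigma>(2 := w)) p) j)
        \<longrightarrow> tval (\<sigma>(2 := w)) (Var 2) = tval (\<sigma>(2 := w)) (Var u)))"
    unfolding F_def L_def using py u
    by (intro rep_Con rep_Le E(2) rep_ball rep_Imp[OF C(2) rep_Eq]) auto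
  then have repF: "rep F (\<lambda>\<sigma>. ?P (\<sigma> p) (\<sigma> u) (\<sigma> y))"
    using py u by simp
  define \<theta> where "\<theta> = Ex u F"
  have "fv \<theta> \<subseteq> {p, y}" using fvF by (auto simp: \<theta>_def)
  moreover have "T \<turnstile> subst (subst \<theta> p (num m)) y (num d) \<and>
      T \<turnstile> Imp (subst \<theta> p (num m)) (Eq (Var y) (num d))"
    if run: "run e [m] = Some d" for m d
  proof -
    obtain w where "S w m d" using run unfolding S(3) ..
    then have ex: "\<exists>w. d \<le> w \<and> S w m d" using S(2) by (intro exI[of _ "max d w"]) auto
    \<comment> \<open>The standard least bound: it is at least the value \<open>d\<close> and is
      itself a witness.\<close>
    define w0 where "w0 = (LEAST w. d \<le> w \<and> S w m d)"
    have w0: "d \<le> w0" "S w0 m d" using LeastI_ex[OF ex] by (auto simp: w0_def)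
    have least: "w0 \<le> w" if "d \<le> w" "S w m d" for w
      unfolding w0_def using that by (intro Least_le) auto
    have unique: "j = d" if "S w m j" for w j
    proof -
      have "run e [m] = Some j" unfolding S(3) using that ..
      with run show ?thesis by simp
    qed
    \<comment> \<open>\<open>S k m d\<close> follows from a smaller witness by monotonicity, so
      \<open>w0 \<le> k\<close>; minimality of \<open>k\<close>, applied at \<open>w0\<close>, then
      forces equality.\<close>
    have P_iff: "?P m k j \<longleftrightarrow> k = w0 \<and> j = d" for k j
    proof
      assume P: "?P m k j"
      then obtain w where w: "w \<le> k" "S w m j" by blast
      then have j: "j = d" using unique by blast
      with w P have "w0 \<le> k" by (intro least) (auto intro: S(2))
      with P w0 j show "k = w0 \<and> j = d" by blast
    next
      assume kj: "k = w0 \<and> j = d"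
      have "w = w0" if "w \<le> w0" "i \<le> w" "S w m i" for w i
        using that unique least by (metis antisym)
      with kj w0 show "?P m k j" by blast
    qed
    define F' where "F' = subst F p (num m)"
    define E' where "E' = subst E p (num m)"
    define C' where "C' = subst C p (num m)"
    define L' where "L' = All 2 (Imp (Le (Var 2) (Var u)) (Imp C' (Eq (Var 2) (Var u))))"
    have F': "F' = Con (Le (Var y) (Var u)) (Con E' L')"
      using py u by (simp add: F'_def F_def L_def E'_def C'_def L'_def)
    have inst: "subst (subst F' u (num k)) y (num j)
        = msubst (\<lambda>i. num (((\<lambda>_. 0)(p := m, u := k, y := j)) i)) F" for k j
      unfolding F'_def subst_eq_msubst
      using fvF py u by (subst (1 2) msubst_msubst) (auto simp: tame_def intro!: msubst_cong)
    have true: "T \<turnstile> subst (subst F' u (num w0)) y (num d)"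
      unfolding inst using P_iff[of d w0] py u by (intro rep_true[OF repF]) simp
    have false: "T \<turnstile> Neg (subst (subst F' u (num k)) y (num j))" if "\<not> (k = w0 \<and> j = d)" for k j
      unfolding inst using P_iff[of j k] py u that by (intro rep_false[OF repF]) simp
    \<comment> \<open>This is why \<open>u\<close> must bound the value too: once \<open>u\<close>
      is a numeral, the first conjunct of \<open>F'\<close> leaves only numerals for
      \<open>y\<close>, and there \<open>F'\<close> is decided.\<close>
    have A: "T \<turnstile> Imp (subst F' u (num k)) (Con (Eq (num k) (num w0)) (Eq (Var y) (num d)))" for k
    proof -
      have "T \<turnstile> Imp (Le (Var y) (num k))
          (Imp (subst F' u (num k)) (Con (Eq (num k) (num w0)) (Eq (Var y) (num d))))"
      proof (rule Le_cases)
        fix j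
        have "T \<turnstile> Imp (subst (subst F' u (num k)) y (num j))
            (Con (Eq (num k) (num w0)) (Eq (num j) (num d)))"
        proof (cases "k = w0 \<and> j = d")
          case True
          have "T \<turnstile> Imp (subst (subst F' u (num k)) y (num j))
              (Con (Eq (num w0) (num w0)) (Eq (num d) (num d)))"
            using eq_refl[of T "num w0"] eq_refl[of T "num d"]
            by (rule taut2) (auto simp: tautology_def)
          with True show ?thesis by simp
        next
          case False
          from false[OF this] show ?thesis by (rule taut1) (auto simp: tautology_def)
        qed
        then show "T \<turnstile> subst (Imp (subst F' u (num k))
            (Con (Eq (num k) (num w0)) (Eq (Var y) (num d)))) y (num j)"
          by simp
      qed (use py in auto)
      then show ?thesis
        by (rule taut1) (use u in \<open>auto simp: tautology_def F'\<close>)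
    qed
    have B: "T \<turnstile> Imp (Le (Var u) (num w0)) (Imp F' (Con (Eq (Var u) (num w0)) (Eq (Var y) (num d))))"
      using A u by (intro Le_cases) auto
    \<comment> \<open>\<open>w0\<close> is provably a candidate, with \<open>d\<close> as the value
      below it; hence the minimality clause can be applied to it.\<close>
    have C'w0: "T \<turnstile> subst C' 2 (num w0)"
    proof -
      have "subst C' 2 (num w0) = msubst (\<lambda>i. num (((\<lambda>_. 0)(p := m, 2 := w0)) i)) C"
        unfolding C'_def subst_eq_msubst
        using C(1) py by (subst msubst_msubst) (auto simp: tame_def intro!: msubst_cong)
      then show ?thesis
        using py w0 by (auto intro!: rep_true[OF C(2)])
    qed
    have "T \<turnstile> Imp L' (subst (Imp (Le (Var 2) (Var u)) (Imp C' (Eq (Var 2) (Var u)))) 2 (num w0))"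
      unfolding L'_def by (rule spec) (simp only: free_for_num)
    then have "T \<turnstile> Imp L' (Imp (Le (num w0) (Var u)) (Imp (subst C' 2 (num w0)) (Eq (num w0) (Var u))))"
      using u by simp
    then have D: "T \<turnstile> Imp (Le (num w0) (Var u)) (Imp L' (Eq (Var u) (num w0)))"
      using C'w0 eq_sym[of T "num w0" "Var u"]
      by (rule taut3) (auto simp: tautology_def)
    \<comment> \<open>Totality of the order against the numeral of \<open>w0\<close>:
      \<open>B\<close> settles \<open>u\<close> below it, \<open>D\<close> settles \<open>u\<close>
      above it, standard or not.\<close>
    have "T \<turnstile> Imp F' (Eq (Var u) (num w0))"
      using Le_total[of u w0] B D by (rule taut3) (use u in \<open>auto simp: tautology_def F'\<close>)
    then have F'_imp: "T \<turnstile> Imp F' (Eq (Var y) (num d))"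
      using eq_instance[of T u w0 F'] A[of w0]
      by (rule taut3) (auto simp: tautology_def simp del: subst.simps)
    then have "T \<turnstile> Imp (Neg (Eq (Var y) (num d))) (Neg F')"
      by (rule taut1) (auto simp: tautology_def)
    then have "T \<turnstile> Imp (Neg (Eq (Var y) (num d))) (All u (Neg F'))"
      by (rule gen_imp) (use u in auto)
    then have "T \<turnstile> Imp (Ex u F') (Eq (Var y) (num d))"
      by (rule taut1) (auto simp: tautology_def)
    moreover have "T \<turnstile> Ex u (subst F' y (num d))"
    proof (rule ex_intro)
      have "subst (subst F' y (num d)) u (num w0) = subst (subst F' u (num w0)) y (num d)"
        unfolding inst unfolding F'_def subst_eq_msubst
        using fvF py u by (subst (1 2) msubst_msubst) (auto simp: tame_def intro!: msubst_cong)
      with true show "T \<turnstile> subst (subst F' y (num d)) u (num w0)" by simp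
    qed simp
    ultimately show ?thesis
      using u by (simp add: \<theta>_def F'_def)
  qed
  ultimately show ?thesis by blast
qed

end

section \<open>Diagonalisation\<close>

primrec const_prog :: "nat \<Rightarrow> prog" where
  "const_prog 0 = Zr"
| "const_prog (Suc n) = Comp Sc [const_prog n]"

lemma run_const_prog [simp]: "run (const_prog n) xs = Some n"
  by (induction n) auto

lemma str_tm_nonempty [simp]: "str_tm t \<noteq> []"
  by (cases t) auto

lemma str_fm_nonempty [simp]: "str_fm \<phi> \<noteq> []"
  by (cases \<phi>) auto

lemma concat_prog:
  assumes "computable_simulation \<alpha>"
  obtains e where "\<And>u v. u \<noteq> [] \<Longrightarrow> v \<noteq> [] \<Longrightarrow> run e [\<alpha> u, \<alpha> v] = Some (\<alpha> (u @ v))"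
proof -
  have inj: "inj_on \<alpha> A_star"
    using assms by (simp add: computable_simulation_def numbering_def)
  obtain e where e: "\<And>m n. run e [m, n] = code_concat \<alpha> m n"
    using assms by (auto simp: computable_simulation_def recursive2_def)
  have "run e [\<alpha> u, \<alpha> v] = Some (\<alpha> (u @ v))" if "u \<noteq> []" "v \<noteq> []" for u v
    using that inj by (simp add: e code_concat_def A_star_def inv_into_f_f)
  then show ?thesis by (rule that)
qed

text \<open>Prefixing \<open>p = m\<close> to a formula instead of substituting the numeral of \<open>m\<close> for \<open>p\<close> makes the
  diagonal function a composition of concatenations, so no parsing of strings is needed.\<close>

definition diag :: "nat \<Rightarrow> fm \<Rightarrow> nat \<Rightarrow> fm" where
  "diag p \<phi> m = All p (Imp (Eq (Var p) (num m)) \<phi>)"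

text \<open>The input number is used twice: as the code of the string of \<open>\<phi>\<close>, to
  be concatenated, and as the number whose numeral is to be written down.\<close>

lemma diag_prog:
  assumes "computable_simulation \<alpha>"
  obtains e where "\<And>\<phi>. run e [\<alpha> (str_fm \<phi>)] = Some (\<alpha> (str_fm (diag p \<phi> (\<alpha> (str_fm \<phi>)))))"
proof -
  obtain c where c: "\<And>u v. u \<noteq> [] \<Longrightarrow> v \<noteq> [] \<Longrightarrow> run c [\<alpha> u, \<alpha> v] = Some (\<alpha> (u @ v))"
    using concat_prog[OF assms] by blast
  \<comment> \<open>The numeral of a successor is one more letter in front of the previous numeral,
    whose code is the value read by \<open>Proj 1\<close>.\<close>
  define N where "N = PrimRec (const_prog (\<alpha> [LZero])) (Comp c [const_prog (\<alpha> [LSuc]), Proj 1])"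
  have N: "run N [n] = Some (\<alpha> (str_tm (num n)))" for n
  proof -
    have "rec_nat (Some (\<alpha> [LZero])) (\<lambda>k. case_option None (\<lambda>y. run c [\<alpha> [LSuc], y])) n
      = Some (\<alpha> (str_tm (num n)))"
      by (induction n) (simp_all add: c)
    then show ?thesis by (simp add: N_def)
  qed
  let ?v = "LVar # replicate p LPrime"
  let ?pre = "[LAll] @ ?v @ [LNot, LOpen, LOpen] @ ?v @ [LEq]"
  \<comment> \<open>The pieces come from the unabbreviated implication, a negated conjunction whose
    second member is negated. All of them are nonempty, as concatenation of codes requires.\<close>
  define e where "e = Comp c [const_prog (\<alpha> ?pre), Comp c [N,
    Comp c [const_prog (\<alpha> [LClose, LAnd, LNot]), Comp c [Proj 0, const_prog (\<alpha> [LClose])]]]]"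
  have "run e [\<alpha> (str_fm \<phi>)] = Some (\<alpha> (str_fm (diag p \<phi> (\<alpha> (str_fm \<phi>)))))" for \<phi>
    by (simp add: e_def N c diag_def)
  then show ?thesis by (rule that)
qed

section \<open>The fixed point\<close>

context R_extension
begin

text \<open>\<open>\<phi>\<close> says that every value of the diagonal function at \<open>p\<close>
  satisfies \<open>X\<close>, and \<open>G\<close> is the diagonal of \<open>\<phi>\<close> itself.
  Hence the value in question is the code of \<open>G\<close>.\<close>

lemma diagonal_lemma:
  assumes "computable_simulation \<alpha>" and X: "fv X \<subseteq> {x}"
  obtains G where "sentence G"
    "T \<turnstile> Imp G (subst X x (quote \<alpha> G))" "T \<turnstile> Imp (subst X x (quote \<alpha> G)) G"
proof -
  define p where "p = x + 3"
  define y where "y = x + 4"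
  have py: "3 \<le> p" "3 \<le> y" "p \<noteq> y" "x \<noteq> p" "x \<noteq> y" by (auto simp: p_def y_def)
  obtain e where e: "\<And>\<phi>. run e [\<alpha> (str_fm \<phi>)] = Some (\<alpha> (str_fm (diag p \<phi> (\<alpha> (str_fm \<phi>)))))"
    using diag_prog[OF assms(1)] by blast
  obtain \<theta> where \<theta>: "fv \<theta> \<subseteq> {p, y}"
    "\<And>m d. run e [m] = Some d \<Longrightarrow> T \<turnstile> subst (subst \<theta> p (num m)) y (num d)"
    "\<And>m d. run e [m] = Some d \<Longrightarrow> T \<turnstile> Imp (subst \<theta> p (num m)) (Eq (Var y) (num d))"
    using function_representable[OF py(1-3), of e] by blast
  \<comment> \<open>Direct substitution of the variable \<open>y\<close> for \<open>x\<close> could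
    be captured by a binder inside \<open>X\<close>; the quantified equation avoids this.\<close>
  define Y where "Y = All x (Imp (Eq (Var x) (Var y)) X)"
  define \<phi> where "\<phi> = All y (Imp \<theta> Y)"
  define m where "m = \<alpha> (str_fm \<phi>)"
  define G where "G = diag p \<phi> m"
  define d where "d = \<alpha> (str_fm G)"
  have d: "run e [m] = Some d" unfolding d_def G_def m_def by (rule e)
  have fv\<phi>: "fv \<phi> \<subseteq> {p}" using \<theta>(1) X by (auto simp: \<phi>_def Y_def)
  let ?Xd = "subst X x (num d)" and ?\<theta> = "subst \<theta> p (num m)"
  define Yd where "Yd = All x (Imp (Eq (Var x) (num d)) X)"
  have Yd: "subst Y y (num d) = Yd"
    using py X by (auto simp: Y_def Yd_def intro!: subst_fresh)
  have "subst Y p (num m) = Y" using py X by (intro subst_fresh) (auto simp: Y_def)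
  then have \<phi>m: "subst \<phi> p (num m) = All y (Imp ?\<theta> Y)"
    using py by (simp add: \<phi>_def)
  have Yd_Xd: "T \<turnstile> Imp Yd ?Xd"
  proof -
    have "T \<turnstile> Imp Yd (subst (Imp (Eq (Var x) (num d)) X) x (num d))"
      unfolding Yd_def by (rule spec) (simp only: free_for_num)
    then have "T \<turnstile> Imp Yd (Imp (Eq (num d) (num d)) ?Xd)" by simp
    then show ?thesis using eq_refl by (rule taut2) (auto simp: tautology_def)
  qed
  have Xd_Yd: "T \<turnstile> Imp ?Xd Yd"
  proof -
    have "T \<turnstile> Imp ?Xd (Imp (Eq (Var x) (num d)) X)"
      using eq_replace by (rule taut1) (auto simp: tautology_def)
    then show ?thesis unfolding Yd_def by (rule gen_imp) (use X in auto)
  qed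
  have G_\<phi>m: "T \<turnstile> Imp G (subst \<phi> p (num m))"
  proof -
    have "T \<turnstile> Imp G (subst (Imp (Eq (Var p) (num m)) \<phi>) p (num m))"
      unfolding G_def diag_def by (rule spec) (simp only: free_for_num)
    then have "T \<turnstile> Imp G (Imp (Eq (num m) (num m)) (subst \<phi> p (num m)))" by simp
    then show ?thesis using eq_refl by (rule taut2) (auto simp: tautology_def)
  qed
  have \<phi>m_G: "T \<turnstile> Imp (subst \<phi> p (num m)) G"
  proof -
    have "T \<turnstile> Imp (subst \<phi> p (num m)) (Imp (Eq (Var p) (num m)) \<phi>)"
      using eq_replace by (rule taut1) (auto simp: tautology_def)
    then show ?thesis unfolding G_def diag_def by (rule gen_imp) simp
  qed
  have \<phi>m_Xd: "T \<turnstile> Imp (subst \<phi> p (num m)) ?Xd"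
  proof -
    have "T \<turnstile> Imp (subst \<phi> p (num m)) (subst (Imp ?\<theta> Y) y (num d))"
      unfolding \<phi>m by (rule spec) (simp only: free_for_num)
    then have "T \<turnstile> Imp (subst \<phi> p (num m)) (Imp (subst ?\<theta> y (num d)) Yd)"
      by (simp add: Yd)
    then show ?thesis using \<theta>(2)[OF d] Yd_Xd by (rule taut3) (auto simp: tautology_def)
  qed
  \<comment> \<open>The converse needed only the true instance of \<open>\<theta>\<close>. Here
    provable functionality is essential: whatever satisfies \<open>\<theta>\<close> is
    \<open>num d\<close>.\<close>
  have Xd_\<phi>m: "T \<turnstile> Imp ?Xd (subst \<phi> p (num m))"
  proof -
    have "T \<turnstile> Imp (Eq (Var y) (num d)) (Imp Yd Y)"
      using eq_replace[of T y d Y] by (simp add: Yd)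
    with \<theta>(3)[OF d] Xd_Yd have "T \<turnstile> Imp ?Xd (Imp ?\<theta> Y)"
      by (rule taut3) (auto simp: tautology_def)
    then show ?thesis unfolding \<phi>m by (rule gen_imp) (use X in auto)
  qed
  show ?thesis
  proof
    show "sentence G" using fv\<phi> by (auto simp: sentence_def G_def diag_def)
    show "T \<turnstile> Imp G (subst X x (quote \<alpha> G))"
      using imp_trans[OF G_\<phi>m \<phi>m_Xd] unfolding d_def quote_def .
    show "T \<turnstile> Imp (subst X x (quote \<alpha> G)) G"
      using imp_trans[OF Xd_\<phi>m \<phi>m_G] unfolding d_def quote_def .
  qed
qed

end

section \<open>Loeb's derivation of the second incompleteness theorem\<close>

theorem theorem4p11:
  fixes T :: "fm set" and \<alpha> :: "str \<Rightarrow> nat" and Pr falsum :: fm and x :: nat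
  assumes "is_theory T" and "consistent T" and "re_theory T" and "extends_R T"
    and "sentence falsum" and "T \<turnstile> Neg falsum"
    and "computable_simulation \<alpha>"
    and "fv Pr \<subseteq> {x}" and "Loeb T \<alpha> Pr x"
  shows "\<not> (T \<turnstile> Neg (subst Pr x (quote \<alpha> falsum)))"
proof
  assume con: "T \<turnstile> Neg (subst Pr x (quote \<alpha> falsum))"
  interpret R_extension T by unfold_locales fact
  define B where "B = (\<lambda>\<phi>. subst Pr x (quote \<alpha> \<phi>))"
  have sB: "sentence (B \<phi>)" for \<phi>
    using assms(8) by (auto simp: B_def quote_def sentence_def)
  have L1: "T \<turnstile> \<phi> \<Longrightarrow> T \<turnstile> B \<phi>" if "sentence \<phi>" for \<phi>
    using assms(9) that by (simp add: Loeb_def B_def)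
  have L2: "T \<turnstile> Imp (Con (B \<phi>) (B (Imp \<phi> \<psi>))) (B \<psi>)" if "sentence \<phi>" "sentence \<psi>" for \<phi> \<psi>
    using assms(9) that by (simp add: Loeb_def B_def)
  have L3: "T \<turnstile> Imp (B \<phi>) (B (B \<phi>))" if "sentence \<phi>" for \<phi>
    using assms(9) that by (simp add: Loeb_def B_def)
  have distrib: "T \<turnstile> Imp (B \<phi>) (B \<psi>)" if "T \<turnstile> Imp \<phi> \<psi>" "sentence \<phi>" "sentence \<psi>" for \<phi> \<psi>
  proof -
    have "T \<turnstile> B (Imp \<phi> \<psi>)" using that by (intro L1) (auto simp: sentence_def)
    with L2[OF that(2,3)] show ?thesis by (rule taut2) (auto simp: tautology_def)
  qed
  obtain G where G: "sentence G" "T \<turnstile> Imp G (Neg (B G))" "T \<turnstile> Imp (Neg (B G)) G"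
    using diagonal_lemma[of \<alpha> "Neg Pr" x] assms(7,8) by (auto simp: B_def)
  have s: "sentence (Imp (B G) falsum)" "sentence (Neg (B G))"
    using sB[of G] assms(5) by (auto simp: sentence_def)
  \<comment> \<open>Provability of \<open>G\<close> gives, inside \<open>T\<close>, provability of
    \<open>Imp (B G) falsum\<close>, and by the third condition that of \<open>B G\<close>; together
    they give \<open>B falsum\<close>.\<close>
  have "T \<turnstile> Imp G (Imp (B G) falsum)"
    using G(2) by (rule taut1) (auto simp: tautology_def)
  then have "T \<turnstile> Imp (B G) (B (Imp (B G) falsum))"
    using G(1) s(1) by (rule distrib)
  then have "T \<turnstile> Imp (B G) (B falsum)"
    using L3[OF G(1)] L2[OF sB[of G] assms(5)] by (rule taut3) (auto simp: tautology_def)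
  \<comment> \<open>With \<open>B falsum\<close> refuted, \<open>T\<close> refutes
    \<open>B G\<close>. So it proves \<open>G\<close> by the fixed point, and then
    \<open>B G\<close> by the first condition, contrary to consistency.\<close>
  then have nB: "T \<turnstile> Neg (B G)"
    using con unfolding B_def[symmetric] by (rule taut2) (auto simp: tautology_def B_def)
  with G(3) have "T \<turnstile> G" by (rule mp)
  then have "T \<turnstile> B G" by (rule L1[OF G(1)])
  with nB assms(2) show False by (auto simp: consistent_def)
qed

end
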